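(* For every integer $n\ge 2$, $C(n,n-2)=n\,2^{n-2}$.
   Context: A composition of a positive integer $n$ is a finite sequence $(a_1,\dots,a_m)$ of positive integers with $\sum a_i=n$. Let $V$ be an $n$-dimensional vector space over $\mathbb{C}$ with basis $e_1,\dots,e_n$. For compositions $\mathbf{a}=(a_1,\dots,a_m)$ and $\mathbf{b}=(b_1,\dots,b_t)$ of $n$, the seaweed algebra $\mathfrak{p}^{A}_n(\mathbf{a},\mathbf{b})$ is the subalgebra of $\mathfrak{sl}(n)$ consisting of traceless matrices preserving both flags $V_1\subset\cdots\subset V_m=V$, with $V_i=\mathrm{span}\{e_1,\dots,e_{a_1+\cdots+a_i}\}$, and $V=W_0\supset W_1\supset\cdots\supset W_t=\{0\}$, with $W_j=\mathrm{span}\{e_{b_1+\cdots+b_j+1},\dots,e_n\}$. The index of a finite-dimensional Lie algebra $\mathfrak{g}$ is $\min_{f\in\mathfrak{g}^*}\dim\ker B_f$, where $B_f(x,y)=f([x,y])$. For integers $n\ge1$ and $k$, $C(n,k)$ denotes the number of ordered pairs $(\mathbf{a},\mathbf{b})$ of compositions of $n$ such that $\mathfrak{p}^A_n(\mathbf{a},\mathbf{b})$ has index $k$. *)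

theory Defs
  imports Complex_Main "HOL-Library.Function_Algebras"
begin

text \<open>Matrices over C are modelled as functions nat => nat => complex; an n x n matrix
  has all entries with an index >= n equal to 0. Index i (0-based) corresponds to
  the basis vector e_(i+1). Vectors are functions nat => complex.\<close>

type_synonym cmat = "nat \<Rightarrow> nat \<Rightarrow> complex"

definition mat_scale :: "complex \<Rightarrow> cmat \<Rightarrow> cmat" where
  "mat_scale c X = (\<lambda>i j. c * X i j)"

definition mat_mult :: "nat \<Rightarrow> cmat \<Rightarrow> cmat \<Rightarrow> cmat" where
  "mat_mult n X Y = (\<lambda>i j. \<Sum>k<n. X i k * Y k j)"

definition mat_bracket :: "nat \<Rightarrow> cmat \<Rightarrow> cmat \<Rightarrow> cmat" where
  "mat_bracket n X Y = (\<lambda>i j. mat_mult n X Y i j - mat_mult n Y X i j)"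

definition mat_vec :: "nat \<Rightarrow> cmat \<Rightarrow> (nat \<Rightarrow> complex) \<Rightarrow> (nat \<Rightarrow> complex)" where
  "mat_vec n X v = (\<lambda>r. \<Sum>c<n. X r c * v c)"

definition coord_span :: "nat set \<Rightarrow> (nat \<Rightarrow> complex) set" where
  "coord_span S = {v. \<forall>k. k \<notin> S \<longrightarrow> v k = 0}"

definition preserves :: "nat \<Rightarrow> cmat \<Rightarrow> (nat \<Rightarrow> complex) set \<Rightarrow> bool" where
  "preserves n X U \<longleftrightarrow> (\<forall>v\<in>U. mat_vec n X v \<in> U)"

definition sl :: "nat \<Rightarrow> cmat set" where
  "sl n = {X. (\<forall>i j. (n \<le> i \<or> n \<le> j) \<longrightarrow> X i j = 0) \<and> (\<Sum>i<n. X i i) = 0}"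

definition compositions :: "nat \<Rightarrow> nat list set" where
  "compositions n = {a. (\<forall>x\<in>set a. 0 < x) \<and> sum_list a = n}"

definition seaweed :: "nat \<Rightarrow> nat list \<Rightarrow> nat list \<Rightarrow> cmat set" where
  "seaweed n a b = {X \<in> sl n.
     (\<forall>i\<in>{1..length a}. preserves n X (coord_span {0..<sum_list (take i a)})) \<and>
     (\<forall>j\<in>{0..length b}. preserves n X (coord_span {sum_list (take j b)..<n}))}"

text \<open>Index of a Lie subalgebra g of gl(n): the minimum over linear functionals f of
  dim ker B_f, where ker B_f = {x in g. for all y in g, f([x,y]) = 0}. Functionals are
  taken as linear maps on the whole matrix space; their restrictions to g are exactly g*.\<close>
definition lie_index :: "nat \<Rightarrow> cmat set \<Rightarrow> nat" where
  "lie_index n g = (LEAST k. \<exists>f :: cmat \<Rightarrow> complex.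
      Vector_Spaces.linear mat_scale (*) f \<and>
      vector_space.dim mat_scale {x\<in>g. \<forall>y\<in>g. f (mat_bracket n x y) = 0} = k)"

definition C :: "nat \<Rightarrow> int \<Rightarrow> nat" where
  "C n k = card {(a, b). a \<in> compositions n \<and> b \<in> compositions n \<and>
                   int (lie_index n (seaweed n a b)) = k}"

end

(* The seaweed algebra of (a, b) consists of the trace zero matrices supported on the index pairs
   (i, j) with i <= j in one block of b or i >= j in one block of a. It is easier to work with its
   extension by the scalar matrices, whose index is larger by one.

   Upper bounds: Panyushev's reduction replaces (a, b) by a pair for a smaller n without decreasing the
   index. As n drops whenever the first parts differ, the extended index can be n only if a = b, and
   n - 1 only if b arises from a by merging consecutive parts 1, k - 2, 1 into k (the meander graphs
   then differ in a single arc), or vice versa.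

   Lower bounds: for a = b the radical is the centralizer of a matrix in a block diagonal algebra, of
   dimension at least n by triangularization. The one-arc case reduces to this one by eliminating a
   Heisenberg algebra when the functional does not vanish on its center, and by
   semicontinuity otherwise.

   Pairs differing by one arc correspond to a part k >= 2 of a composition, which gives the count. *)

theory Submission
  imports Defs "Jordan_Normal_Form.Schur_Decomposition"
begin

section \<open>Linear functionals and dimensions of spaces of matrices\<close>

text \<open>The index is a minimum over functionals: an upper bound needs one good functional, a
  lower bound has to handle every functional. The reductions are used only in the first direction,
  where an injection of kernels for one constructed functional is enough; equality would also
  require control of degenerate functionals. Lower bounds are therefore proved only for the two
  families in question, by arguments valid for all functionals, and no exact index is computed for
  the remaining pairs. Scalar matrices are added because the extended algebra has a basis of matrix
  units. A functional is then a matrix \<open>F\<close> of values on them, its kernel is given by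
  the equations \<open>pairing\<close>, and no trace condition has to be carried through the
  reductions. The identity matrix lies in every kernel and has nonzero trace, which accounts for the
  shift by one.\<close>

interpretation cmat: vector_space mat_scale
  by unfold_locales (auto simp: mat_scale_def algebra_simps fun_eq_iff)

definition functional :: "(cmat \<Rightarrow> complex) \<Rightarrow> bool" where
  "functional f \<longleftrightarrow> Vector_Spaces.linear mat_scale (*) f"

lemma functional_iff:
  "functional f \<longleftrightarrow> (\<forall>x y. f (x + y) = f x + f y) \<and> (\<forall>c x. f (mat_scale c x) = c * f x)"
proof -
  have "vector_space ((*) :: complex \<Rightarrow> complex \<Rightarrow> complex)"
    by unfold_locales (auto simp: algebra_simps)
  then show ?thesis
    unfolding functional_def Vector_Spaces.linear_iff using cmat.vector_space_axioms by blast
qed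

lemma functional_add: "functional f \<Longrightarrow> f (x + y) = f x + f y"
  and functional_scale: "functional f \<Longrightarrow> f (mat_scale c x) = c * f x"
  by (auto simp: functional_iff)

lemma functional_0: "functional f \<Longrightarrow> f 0 = 0"
  using functional_scale[of f 0 0] by simp

lemma functional_diff: "functional f \<Longrightarrow> f (x - y) = f x - f y"
  using functional_add[of f "x - y" y] by simp

lemma functional_sum: "functional f \<Longrightarrow> f (\<Sum>i\<in>A. g i) = (\<Sum>i\<in>A. f (g i))"
  by (induction A rule: infinite_finite_induct) (auto simp: functional_0 functional_add)

lemma functional_entry: "functional (\<lambda>x. x i j)"
  by (simp add: functional_iff mat_scale_def)

lemma functional_lincomb:
  assumes "\<And>k. k \<in> A \<Longrightarrow> functional (f k)"
  shows "functional (\<lambda>x. \<Sum>k\<in>A. f k x * c k)"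
  unfolding functional_iff
proof (intro conjI allI)
  fix x y a
  have "(\<Sum>k\<in>A. f k (x + y) * c k) = (\<Sum>k\<in>A. f k x * c k + f k y * c k)"
    using assms by (intro sum.cong) (simp_all add: functional_add distrib_right)
  then show "(\<Sum>k\<in>A. f k (x + y) * c k) = (\<Sum>k\<in>A. f k x * c k) + (\<Sum>k\<in>A. f k y * c k)"
    by (simp only: sum.distrib)
  show "(\<Sum>k\<in>A. f k (mat_scale a x) * c k) = a * (\<Sum>k\<in>A. f k x * c k)"
    unfolding sum_distrib_left using assms by (intro sum.cong) (simp_all add: functional_scale mult.assoc)
qed

lemma functional_minus: "functional f \<Longrightarrow> functional g \<Longrightarrow> functional (\<lambda>x. f x - g x)"
  by (auto simp: functional_iff algebra_simps)

section \<open>Subspaces of matrices with prescribed support\<close>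

definition supported :: "(nat \<times> nat) set \<Rightarrow> cmat set" where
  "supported S = {x. \<forall>i j. (i, j) \<notin> S \<longrightarrow> x i j = 0}"

lemma supportedD: "x \<in> supported S \<Longrightarrow> (i, j) \<notin> S \<Longrightarrow> x i j = 0"
  by (simp add: supported_def)

lemma supported_mono: "S \<subseteq> T \<Longrightarrow> supported S \<subseteq> supported T"
  by (auto simp: supported_def)

lemma subspace_supported: "cmat.subspace (supported S)"
  by (auto simp: cmat.subspace_def supported_def mat_scale_def)

lemma subspace_common_zeros:
  assumes "cmat.subspace K" "\<And>\<phi>. \<phi> \<in> \<Phi> \<Longrightarrow> functional \<phi>"
  shows "cmat.subspace {x \<in> K. \<forall>\<phi>\<in>\<Phi>. \<phi> x = 0}"
  using assms by (auto simp: cmat.subspace_def functional_0 functional_add functional_scale)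

definition unit_mat :: "nat \<times> nat \<Rightarrow> cmat" where
  "unit_mat s = (\<lambda>i j. if (i, j) = s then 1 else 0)"

lemma sum_fun_apply: "(\<Sum>a\<in>A. (f a :: cmat)) i j = (\<Sum>a\<in>A. f a i j)"
  by (induction A rule: infinite_finite_induct) auto

lemma supported_expand:
  assumes "finite S" "x \<in> supported S"
  shows "x = (\<Sum>s\<in>S. mat_scale (x (fst s) (snd s)) (unit_mat s))"
proof (intro ext)
  fix i j
  have "(\<Sum>s\<in>S. mat_scale (x (fst s) (snd s)) (unit_mat s) i j)
      = (\<Sum>s\<in>S. if s = (i, j) then x i j else 0)"
    by (intro sum.cong) (auto simp: mat_scale_def unit_mat_def)
  also have "\<dots> = x i j"
    using assms by (auto simp: supported_def)
  finally show "x i j = (\<Sum>s\<in>S. mat_scale (x (fst s) (snd s)) (unit_mat s)) i j"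
    by (simp add: sum_fun_apply)
qed

lemma supported_span: "finite S \<Longrightarrow> supported S \<subseteq> cmat.span (unit_mat ` S)"
proof
  fix x assume "finite S" "x \<in> supported S"
  then have "x = (\<Sum>s\<in>S. mat_scale (x (fst s) (snd s)) (unit_mat s))"
    by (rule supported_expand)
  also have "\<dots> \<in> cmat.span (unit_mat ` S)"
    by (intro cmat.span_sum cmat.span_scale cmat.span_base) auto
  finally show "x \<in> cmat.span (unit_mat ` S)" .
qed

lemma dim_supported:
  assumes "finite S" shows "cmat.dim (supported S) = card S"
proof (rule cmat.dim_unique)
  show "unit_mat ` S \<subseteq> supported S" by (auto simp: supported_def unit_mat_def)
  show "supported S \<subseteq> cmat.span (unit_mat ` S)" by (rule supported_span[OF assms])
  have inj: "inj_on unit_mat S"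
  proof (rule inj_onI)
    fix s t assume "unit_mat s = unit_mat t"
    then have "unit_mat s (fst s) (snd s) = unit_mat t (fst s) (snd s)" by simp
    then show "s = t" by (auto simp: unit_mat_def split: if_splits)
  qed
  then show "card (unit_mat ` S) = card S" by (rule card_image)
  show "cmat.independent (unit_mat ` S)"
  proof (rule cmat.independent_if_scalars_zero)
    fix f x assume z: "(\<Sum>x\<in>unit_mat ` S. mat_scale (f x) x) = 0" and "x \<in> unit_mat ` S"
    then obtain s where s: "s \<in> S" "x = unit_mat s" by auto
    have "(\<Sum>t\<in>S. mat_scale (f (unit_mat t)) (unit_mat t)) = 0"
      using z by (simp add: sum.reindex[OF inj])
    then have "(\<Sum>t\<in>S. mat_scale (f (unit_mat t)) (unit_mat t)) (fst s) (snd s) = 0"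
      by simp
    then have "(\<Sum>t\<in>S. mat_scale (f (unit_mat t)) (unit_mat t) (fst s) (snd s)) = 0"
      by (simp add: sum_fun_apply)
    moreover have "(\<Sum>t\<in>S. mat_scale (f (unit_mat t)) (unit_mat t) (fst s) (snd s))
        = (\<Sum>t\<in>S. if t = s then f x else 0)"
      by (intro sum.cong) (auto simp: mat_scale_def unit_mat_def s)
    ultimately show "f x = 0" using s assms by simp
  qed (use assms in auto)
qed

text \<open>All of \<open>cmat\<close> is infinite-dimensional, and an infinite basis would have
  \<open>card\<close> 0. The finite support is what makes \<open>cmat.dim\<close> a true dimension
  for the spaces used here.\<close>

lemma finite_basis:
  assumes "finite S" "K \<subseteq> supported S"
  obtains B where "B \<subseteq> K" "cmat.independent B" "K \<subseteq> cmat.span B" "card B = cmat.dim K" "finite B"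
proof -
  obtain B where B: "B \<subseteq> K" "cmat.independent B" "K \<subseteq> cmat.span B" "card B = cmat.dim K"
    by (rule cmat.basis_exists)
  then have "finite B"
    using cmat.independent_span_bound[of "unit_mat ` S" B] supported_span[OF assms(1)] assms by blast
  with B show thesis using that by blast
qed

text \<open>Bounding the dimension of a subspace by the size of a separating set of functionals makes
  the bound easy to transport along linear injections.\<close>

definition separated :: "cmat set \<Rightarrow> nat \<Rightarrow> bool" where
  "separated K d \<longleftrightarrow> (\<exists>\<Phi>. finite \<Phi> \<and> card \<Phi> \<le> d \<and> (\<forall>\<phi>\<in>\<Phi>. functional \<phi>) \<and>
     (\<forall>x\<in>K. (\<forall>\<phi>\<in>\<Phi>. \<phi> x = 0) \<longrightarrow> x = 0))"

text \<open>Each functional lowers the dimension by at most one: a basis of its zeros in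
  \<open>K\<close>, together with a single vector of \<open>K\<close> outside them, spans
  \<open>K\<close>.\<close>

lemma dim_le_card_functionals:
  assumes "finite S" "finite \<Phi>"
  shows "\<lbrakk>cmat.subspace K; K \<subseteq> supported S; \<forall>\<phi>\<in>\<Phi>. functional \<phi>;
    \<forall>x\<in>K. (\<forall>\<phi>\<in>\<Phi>. \<phi> x = 0) \<longrightarrow> x = 0\<rbrakk> \<Longrightarrow> cmat.dim K \<le> card \<Phi>"
  using assms(2)
proof (induction \<Phi> arbitrary: K rule: finite_induct)
  case empty
  then have "K \<subseteq> {0}" by blast
  then have "K \<subseteq> cmat.span {}" by simp
  from cmat.dim_le_card[OF this] show ?case by simp
next
  case (insert \<phi> \<Phi>)
  let ?K = "{x \<in> K. \<forall>\<psi>\<in>{\<phi>}. \<psi> x = 0}"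
  have \<phi>: "functional \<phi>" using insert.prems by simp
  have "cmat.subspace ?K"
    using insert.prems by (intro subspace_common_zeros) auto
  then have le: "cmat.dim ?K \<le> card \<Phi>"
    using insert.prems by (intro insert.IH) auto
  have sub: "?K \<subseteq> supported S" using insert.prems by auto
  obtain B where B: "B \<subseteq> ?K" "cmat.independent B" "?K \<subseteq> cmat.span B" "card B = cmat.dim ?K" "finite B"
    by (rule finite_basis[OF assms(1) sub])
  show ?case
  proof (cases "\<forall>x\<in>K. \<phi> x = 0")
    case True
    then have "?K = K" by auto
    then show ?thesis using le insert by simp
  next
    case False
    then obtain x0 where x0: "x0 \<in> K" "\<phi> x0 \<noteq> 0" by auto
    have "K \<subseteq> cmat.span (insert x0 B)"
    proof
      fix x assume x: "x \<in> K"
      let ?c = "\<phi> x / \<phi> x0"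
      have "x - mat_scale ?c x0 \<in> ?K"
        using x x0 insert.prems(1) \<phi>
        by (auto simp: functional_diff functional_scale intro: cmat.subspace_diff cmat.subspace_scale)
      then have "x - mat_scale ?c x0 \<in> cmat.span (insert x0 B)"
        using B cmat.span_mono[of B "insert x0 B"] by blast
      moreover have "mat_scale ?c x0 \<in> cmat.span (insert x0 B)"
        by (intro cmat.span_scale cmat.span_base) simp
      ultimately have "x - mat_scale ?c x0 + mat_scale ?c x0 \<in> cmat.span (insert x0 B)"
        by (rule cmat.span_add)
      then show "x \<in> cmat.span (insert x0 B)" by simp
    qed
    from cmat.dim_le_card[OF this] have "cmat.dim K \<le> card (insert x0 B)" using B by simp
    also have "\<dots> \<le> Suc (card B)" by (rule card_insert_le_m1) simp_all
    finally show ?thesis using le B insert by simp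
  qed
qed

lemma dim_le_separated:
  assumes "finite S" "cmat.subspace K" "K \<subseteq> supported S" "separated K d"
  shows "cmat.dim K \<le> d"
proof -
  obtain \<Phi> where \<Phi>: "finite \<Phi>" "card \<Phi> \<le> d" "\<forall>\<phi>\<in>\<Phi>. functional \<phi>"
     "\<forall>x\<in>K. (\<forall>\<phi>\<in>\<Phi>. \<phi> x = 0) \<longrightarrow> x = 0"
    using assms(4) unfolding separated_def by blast
  from dim_le_card_functionals[OF assms(1) \<Phi>(1) assms(2,3) \<Phi>(3,4)] \<Phi>(2) show ?thesis by simp
qed

text \<open>The functionals are a dual basis, extended to all of \<open>cmat\<close>. With
  \<open>dim_le_separated\<close> this makes \<open>separated K d\<close> equivalent to a dimension
  bound for subspaces of finite support.\<close>

lemma separated_dim: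
  assumes "finite S" "K \<subseteq> supported S"
  shows "separated K (cmat.dim K)"
proof -
  obtain B where sub: "B \<subseteq> K" and B: "cmat.independent B" "K \<subseteq> cmat.span B" "card B = cmat.dim K" "finite B"
    by (rule finite_basis[OF assms])
  interpret p: vector_space_pair mat_scale "(*) :: complex \<Rightarrow> complex \<Rightarrow> complex"
    by unfold_locales (auto simp: algebra_simps)
  have "\<exists>g. Vector_Spaces.linear mat_scale (*) g \<and> (\<forall>x\<in>B. g x = (if x = b then 1 else 0))" for b
    by (rule p.linear_independent_extend[OF B(1)])
  then obtain g where g: "\<And>b. functional (g b)" "\<And>b x. x \<in> B \<Longrightarrow> g b x = (if x = b then 1 else 0)"
    unfolding functional_def by metis
  have "x = 0" if x: "x \<in> K" "\<forall>b\<in>B. g b x = 0" for x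
  proof -
    obtain u where u: "x = (\<Sum>b\<in>B. mat_scale (u b) b)"
      using x B cmat.span_finite[OF B(4)] by auto
    have "u b = 0" if "b \<in> B" for b
    proof -
      have "g b x = (\<Sum>c\<in>B. u c * g b c)"
        using g by (simp add: u functional_sum functional_scale)
      also have "\<dots> = (\<Sum>c\<in>B. if c = b then u b else 0)"
        by (intro sum.cong) (auto simp: g(2))
      finally show ?thesis using x that B by simp
    qed
    then show ?thesis by (simp add: u)
  qed
  then show ?thesis
    unfolding separated_def
    by (intro exI[of _ "g ` B"]) (use B g card_image_le[of B g] in auto)
qed

lemma separated_mono: "separated K d \<Longrightarrow> d \<le> e \<Longrightarrow> separated K e"
  unfolding separated_def by (blast intro: le_trans)

lemma separated_transport:
  assumes "separated K d" "\<And>x y. T (x + y) = T x + T y" "\<And>c x. T (mat_scale c x) = mat_scale c (T x)"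
    and "\<And>x. x \<in> K' \<Longrightarrow> T x \<in> K" "\<And>x. x \<in> K' \<Longrightarrow> T x = 0 \<Longrightarrow> x = 0"
  shows "separated K' d"
proof -
  obtain \<Phi> where \<Phi>: "finite \<Phi>" "card \<Phi> \<le> d" "\<forall>\<phi>\<in>\<Phi>. functional \<phi>"
     "\<forall>x\<in>K. (\<forall>\<phi>\<in>\<Phi>. \<phi> x = 0) \<longrightarrow> x = 0"
    using assms(1) unfolding separated_def by blast
  have "card ((\<lambda>\<phi> x. \<phi> (T x)) ` \<Phi>) \<le> d"
    using card_image_le[OF \<Phi>(1)] \<Phi>(2) by (rule le_trans)
  moreover have "functional (\<lambda>x. \<phi> (T x))" if "\<phi> \<in> \<Phi>" for \<phi>
    using that \<Phi>(3) assms(2,3) by (simp add: functional_iff)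
  moreover have "x = 0" if "x \<in> K'" "\<forall>\<phi>\<in>\<Phi>. \<phi> (T x) = 0" for x
    using that \<Phi>(4) assms(4,5) by blast
  ultimately show ?thesis unfolding separated_def
    by (intro exI[of _ "(\<lambda>\<phi> x. \<phi> (T x)) ` \<Phi>"]) (use \<Phi>(1) in simp)
qed

lemma separated_cut:
  assumes "separated {x \<in> K. \<forall>\<phi>\<in>\<Phi>. \<phi> x = 0} d" "finite \<Phi>" "\<forall>\<phi>\<in>\<Phi>. functional \<phi>"
  shows "separated K (d + card \<Phi>)"
proof -
  obtain \<Psi> where \<Psi>: "finite \<Psi>" "card \<Psi> \<le> d" "\<forall>\<phi>\<in>\<Psi>. functional \<phi>"
     "\<forall>x\<in>{x \<in> K. \<forall>\<phi>\<in>\<Phi>. \<phi> x = 0}. (\<forall>\<phi>\<in>\<Psi>. \<phi> x = 0) \<longrightarrow> x = 0"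
    using assms(1) unfolding separated_def by blast
  show ?thesis unfolding separated_def
  proof (intro exI[of _ "\<Psi> \<union> \<Phi>"] conjI)
    show "card (\<Psi> \<union> \<Phi>) \<le> d + card \<Phi>"
      using card_Un_le[of \<Psi> \<Phi>] \<Psi> by simp
  qed (use \<Psi> assms in auto)
qed

lemma dim_le_cut:
  assumes "finite S" "cmat.subspace K" "K \<subseteq> supported S" "finite \<Phi>" "\<forall>\<phi>\<in>\<Phi>. functional \<phi>"
  shows "cmat.dim K \<le> cmat.dim {x \<in> K. \<forall>\<phi>\<in>\<Phi>. \<phi> x = 0} + card \<Phi>"
proof (rule dim_le_separated[OF assms(1-3)], rule separated_cut[OF _ assms(4,5)])
  show "separated {x \<in> K. \<forall>\<phi>\<in>\<Phi>. \<phi> x = 0} (cmat.dim {x \<in> K. \<forall>\<phi>\<in>\<Phi>. \<phi> x = 0})"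
    using assms by (intro separated_dim[OF assms(1)]) auto
qed

lemma dim_le_injective:
  assumes "finite S" "cmat.subspace K'" "K' \<subseteq> supported S" "finite S'" "K \<subseteq> supported S'"
    and "\<And>x y. T (x + y) = T x + T y" "\<And>c x. T (mat_scale c x) = mat_scale c (T x)"
    and "\<And>x. x \<in> K' \<Longrightarrow> T x \<in> K" "\<And>x. x \<in> K' \<Longrightarrow> T x = 0 \<Longrightarrow> x = 0"
  shows "cmat.dim K' \<le> cmat.dim K"
  using dim_le_separated[OF assms(1-3)] separated_transport[OF separated_dim[OF assms(4,5)] assms(6-9)]
  by blast

text \<open>Needed in \<open>separated_perturb\<close>, to recover the entries of a matrix from
  functionals that separate it from 0. The induction splits \<open>K\<close> into the zeros of one
  functional and the multiples of one vector.\<close>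

lemma functional_in_span:
  assumes "finite I" "\<And>i. i \<in> I \<Longrightarrow> functional (\<psi> i)" "functional \<chi>"
    and "cmat.subspace K" "\<And>x. x \<in> K \<Longrightarrow> (\<And>i. i \<in> I \<Longrightarrow> \<psi> i x = 0) \<Longrightarrow> \<chi> x = 0"
  shows "\<exists>c. \<forall>x\<in>K. \<chi> x = (\<Sum>i\<in>I. c i * \<psi> i x)"
  using assms
proof (induction I arbitrary: K rule: finite_induct)
  case empty
  then show ?case by simp
next
  case (insert k I)
  let ?K = "{x \<in> K. \<forall>\<phi>\<in>{\<psi> k}. \<phi> x = 0}"
  have "cmat.subspace ?K" using insert.prems by (intro subspace_common_zeros) auto
  then have "\<exists>c. \<forall>x\<in>?K. \<chi> x = (\<Sum>i\<in>I. c i * \<psi> i x)"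
    using insert.prems by (intro insert.IH) auto
  then obtain c where c: "\<And>x. x \<in> K \<Longrightarrow> \<psi> k x = 0 \<Longrightarrow> \<chi> x = (\<Sum>i\<in>I. c i * \<psi> i x)"
    by auto
  show ?case
  proof (cases "\<forall>x\<in>K. \<psi> k x = 0")
    case True
    then show ?thesis using c insert.hyps by (intro exI[of _ c]) simp
  next
    case False
    then obtain x0 where x0: "x0 \<in> K" "\<psi> k x0 \<noteq> 0" by auto
    \<comment> \<open>Chosen to make both sides agree at \<open>x0\<close>; on the zeros of
      \<open>\<psi> k\<close> they agree by the choice of \<open>c\<close>.\<close>
    define b where "b = (\<chi> x0 - (\<Sum>i\<in>I. c i * \<psi> i x0)) / \<psi> k x0"
    have "\<chi> x = (\<Sum>i\<in>insert k I. (c(k := b)) i * \<psi> i x)" if x: "x \<in> K" for x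
    proof -
      let ?t = "\<psi> k x / \<psi> k x0"
      let ?y = "x - mat_scale ?t x0"
      have "?y \<in> K" using x x0 insert.prems
        by (auto intro: cmat.subspace_diff cmat.subspace_scale)
      moreover have "\<psi> k ?y = 0"
        using x0 insert.prems by (simp add: functional_diff functional_scale)
      ultimately have "\<chi> ?y = (\<Sum>i\<in>I. c i * \<psi> i ?y)" by (rule c)
      then have "\<chi> x - ?t * \<chi> x0 = (\<Sum>i\<in>I. c i * (\<psi> i x - ?t * \<psi> i x0))"
        using insert.prems by (simp add: functional_diff functional_scale)
      also have "\<dots> = (\<Sum>i\<in>I. c i * \<psi> i x) - ?t * (\<Sum>i\<in>I. c i * \<psi> i x0)"
        by (simp add: right_diff_distrib sum_subtractf sum_distrib_left mult.left_commute)
      finally have "\<chi> x = ?t * (\<chi> x0 - (\<Sum>i\<in>I. c i * \<psi> i x0)) + (\<Sum>i\<in>I. c i * \<psi> i x)"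
        by (simp add: algebra_simps)
      also have "?t * (\<chi> x0 - (\<Sum>i\<in>I. c i * \<psi> i x0)) = b * \<psi> k x"
        by (simp add: b_def)
      also have "(\<Sum>i\<in>I. c i * \<psi> i x) = (\<Sum>i\<in>I. (c(k := b)) i * \<psi> i x)"
        using insert.hyps by (intro sum.cong) auto
      finally show ?thesis using insert.hyps by simp
    qed
    then show ?thesis by blast
  qed
qed

section \<open>Forms attached to index patterns\<close>

text \<open>For \<open>F i j = f (E\<^sub>i\<^sub>j)\<close> this is the value \<open>f ([x, E\<^sub>i\<^sub>j])\<close>.\<close>

definition pairing :: "nat \<Rightarrow> cmat \<Rightarrow> nat \<Rightarrow> nat \<Rightarrow> cmat \<Rightarrow> complex" where
  "pairing n F i j x = (\<Sum>k<n. x k i * F k j) - (\<Sum>k<n. x j k * F i k)"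

text \<open>As the matrix units with index pair in \<open>S\<close> span \<open>supported S\<close>,
  testing against them gives the whole kernel of the form on the extended algebra. The trace
  condition returns only in \<open>lie_index_ge\<close> and
  \<open>lie_index_le_separated\<close>.\<close>

definition form_kernel :: "nat \<Rightarrow> (nat \<times> nat) set \<Rightarrow> cmat \<Rightarrow> cmat set" where
  "form_kernel n S F = {x \<in> supported S. \<forall>(i, j)\<in>S. pairing n F i j x = 0}"

lemma functional_pairing: "functional (pairing n F i j)"
  unfolding pairing_def
  by (intro functional_minus functional_lincomb functional_entry)

lemma form_kernel_eq_zeros:
  "form_kernel n S F = {x \<in> supported S. \<forall>\<phi>\<in>(\<lambda>(i, j). pairing n F i j) ` S. \<phi> x = 0}"
  by (auto simp: form_kernel_def)

lemma subspace_form_kernel: "cmat.subspace (form_kernel n S F)"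
  unfolding form_kernel_eq_zeros
  by (intro subspace_common_zeros subspace_supported) (auto simp: functional_pairing)

lemma form_kernel_supported: "form_kernel n S F \<subseteq> supported S"
  by (auto simp: form_kernel_def)

lemma form_kernelD:
  assumes "x \<in> form_kernel n S F"
  shows "(i, j) \<notin> S \<Longrightarrow> x i j = 0"
    and "(i, j) \<in> S \<Longrightarrow> (\<Sum>k<n. x k i * F k j) = (\<Sum>k<n. x j k * F i k)"
  using assms by (auto simp: form_kernel_def supported_def pairing_def)

lemma form_kernelI:
  assumes "\<And>i j. (i, j) \<notin> S \<Longrightarrow> x i j = 0"
    and "\<And>i j. (i, j) \<in> S \<Longrightarrow> (\<Sum>k<n. x k i * F k j) = (\<Sum>k<n. x j k * F i k)"
  shows "x \<in> form_kernel n S F"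
  using assms by (auto simp: form_kernel_def supported_def pairing_def)

text \<open>Transposition is an anti-automorphism, so it merely exchanges the two sums in
  \<open>pairing\<close>, which changes the sign. This is the symmetry between the two
  compositions.\<close>

lemma separated_transpose:
  assumes "separated (form_kernel n S F) d"
  shows "separated (form_kernel n (S\<inverse>) (\<lambda>i j. F j i)) d"
proof (rule separated_transport[OF assms, where T = "\<lambda>x i j. x j i"])
  fix x assume x: "x \<in> form_kernel n (S\<inverse>) (\<lambda>i j. F j i)"
  show "(\<lambda>i j. x j i) \<in> form_kernel n S F"
  proof (rule form_kernelI)
    show "x j i = 0" if "(i, j) \<notin> S" for i j
      using form_kernelD(1)[OF x] that by simp
    show "(\<Sum>k<n. x i k * F k j) = (\<Sum>k<n. x k j * F i k)" if "(i, j) \<in> S" for i j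
      using form_kernelD(2)[OF x, of j i] that by simp
  qed
qed (auto simp: mat_scale_def fun_eq_iff)

lemma dim_transpose:
  assumes "finite S"
  shows "cmat.dim (form_kernel n (S\<inverse>) (\<lambda>i j. F j i)) \<le> cmat.dim (form_kernel n S F)"
  by (rule dim_le_separated[OF _ subspace_form_kernel form_kernel_supported], use assms in simp,
      rule separated_transpose, rule separated_dim[OF assms form_kernel_supported])

lemma sum_single:
  fixes f :: "nat \<Rightarrow> complex"
  assumes "k0 < n" "\<And>k. k < n \<Longrightarrow> k \<noteq> k0 \<Longrightarrow> f k = 0"
  shows "(\<Sum>k<n. f k) = f k0"
  using assms sum.remove[of "{..<n}" k0 f] by (simp add: sum.neutral)

lemma sum_eq_on:
  fixes f g :: "nat \<Rightarrow> complex"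
  assumes "A \<subseteq> {..<n}" "\<And>k. k \<in> A \<Longrightarrow> f k = g k" "\<And>k. k < n \<Longrightarrow> k \<notin> A \<Longrightarrow> f k = 0"
  shows "(\<Sum>k<n. f k) = (\<Sum>k\<in>A. g k)"
  using assms by (intro sum.mono_neutral_cong_right) auto

text \<open>Normalizing \<open>F\<close> to be supported on \<open>S\<close> lets a reduction use
  that the functional of the smaller algebra vanishes outside the smaller pattern.\<close>

definition index_le :: "nat \<Rightarrow> (nat \<times> nat) set \<Rightarrow> nat \<Rightarrow> bool" where
  "index_le n S d \<longleftrightarrow> (\<exists>F\<in>supported S. separated (form_kernel n S F) d)"

lemma index_leI: "F \<in> supported S \<Longrightarrow> separated (form_kernel n S F) d \<Longrightarrow> index_le n S d"
  by (auto simp: index_le_def)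

lemma index_le_transpose: "index_le n S d \<Longrightarrow> index_le n (S\<inverse>) d"
  unfolding index_le_def
proof (elim bexE)
  fix F assume "F \<in> supported S" "separated (form_kernel n S F) d"
  then show "\<exists>F\<in>supported (S\<inverse>). separated (form_kernel n (S\<inverse>) F) d"
    by (intro bexI[of _ "\<lambda>i j. F j i"] separated_transpose) (auto simp: supported_def)
qed

text \<open>The three reduction steps of Panyushev for the index of a seaweed algebra. In each of them only
  an injection of kernels is established, which gives the upper bound for the index.\<close>

lemma reduction_equal:
  fixes S' :: "(nat \<times> nat) set"
  assumes T: "finite T" "T \<subseteq> {..<n}"
    and disj: "\<And>i j. (i, j) \<in> S' \<Longrightarrow> i \<notin> T \<and> j \<notin> T"
    and le: "index_le n S' d"
  shows "index_le n (S' \<union> T \<times> T) (d + card T)"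
proof -
  obtain F' where F': "F' \<in> supported S'" and sep: "separated (form_kernel n S' F') d"
    using le by (auto simp: index_le_def)
  \<comment> \<open>On the block \<open>T\<close> this is diagonal with distinct eigenvalues
    \<open>of_nat i\<close>. The equation at \<open>(t, t')\<close> then multiplies
    \<open>x t' t\<close> by a difference of eigenvalues, so only the \<open>card T\<close> diagonal
    entries of the block survive.\<close>
  define F where "F = (\<lambda>i j. if i \<in> T then (if i = j then of_nat i else 0) else F' i j)"
  let ?K = "form_kernel n (S' \<union> T \<times> T) F"
  let ?\<Phi> = "(\<lambda>t x. x t t) ` T :: (cmat \<Rightarrow> complex) set"
  have card: "card ?\<Phi> \<le> card T" by (rule card_image_le[OF T(1)])
  have F'0: "F' i j = 0" if "i \<in> T \<or> j \<in> T" for i j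
    using disj[of i j] that supportedD[OF F'] by blast
  have "separated {x \<in> ?K. \<forall>\<phi>\<in>?\<Phi>. \<phi> x = 0} d"
  proof (rule separated_transport[OF sep, where T = "\<lambda>x. x"])
    fix x assume "x \<in> {x \<in> ?K. \<forall>\<phi>\<in>?\<Phi>. \<phi> x = 0}"
    then have x: "x \<in> ?K" and diag: "\<And>t. t \<in> T \<Longrightarrow> x t t = 0" by auto
    have off: "x t' t = 0" if "t \<in> T" "t' \<in> T" "t \<noteq> t'" for t t'
    proof -
      have "(\<Sum>k<n. x k t * F k t') = x t' t * F t' t'"
        by (rule sum_single) (use that T F'0 in \<open>auto simp: F_def\<close>)
      moreover have "(\<Sum>k<n. x t' k * F t k) = x t' t * F t t"
        by (rule sum_single) (use that T in \<open>auto simp: F_def\<close>)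
      ultimately have "x t' t * F t' t' = x t' t * F t t"
        using form_kernelD(2)[OF x, of t t'] that by auto
      then show ?thesis using that by (simp add: F_def)
    qed
    have x0: "x i j = 0" if "(i, j) \<notin> S'" for i j
      using that form_kernelD(1)[OF x, of i j] off diag by (cases "i = j") auto
    show "x \<in> form_kernel n S' F'"
    proof (rule form_kernelI)
      show "x i j = 0" if "(i, j) \<notin> S'" for i j using x0 that .
      fix i j assume ij: "(i, j) \<in> S'"
      have l: "(\<lambda>k. x k i * F k j) = (\<lambda>k. x k i * F' k j)"
      proof
        show "x k i * F k j = x k i * F' k j" for k
          using disj x0[of k i] by (cases "k \<in> T") (auto simp: F_def)
      qed
      have r: "(\<lambda>k. x j k * F i k) = (\<lambda>k. x j k * F' i k)"
        using disj[OF ij] by (simp add: F_def)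
      show "(\<Sum>k<n. x k i * F' k j) = (\<Sum>k<n. x j k * F' i k)"
        using form_kernelD(2)[OF x, of i j] ij unfolding l r by simp
    qed
  qed auto
  then have "separated ?K (d + card ?\<Phi>)"
    by (rule separated_cut) (auto simp: T functional_entry)
  then have "separated ?K (d + card T)"
    by (rule separated_mono) (use card in simp)
  moreover have "F \<in> supported (S' \<union> T \<times> T)"
    using supportedD[OF F'] by (auto simp: supported_def F_def)
  ultimately show ?thesis by (rule index_leI[rotated])
qed

text \<open>On the rows in \<open>L\<close> the functional is an identity matrix in the block
  \<open>L \<times> R\<close>, with \<open>\<sigma>\<close> as the identification. The equations at
  \<open>L \<times> (L \<union> M \<union> R)\<close> then make the \<open>L\<close> block of a
  kernel element a copy of its \<open>R\<close> block and kill its entries in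
  \<open>M \<times> R\<close> and \<open>L \<times> R\<close>, while those at
  \<open>M \<times> R\<close> express the entries in \<open>L \<times> M\<close> through the others.
  So the entries in \<open>S'\<close> determine everything.\<close>

lemma reduction_short:
  fixes S' :: "(nat \<times> nat) set"
  assumes S: "S = S' \<union> L \<times> (L \<union> M \<union> R) \<union> M \<times> R"
    and \<sigma>: "inj_on \<sigma> L" "\<sigma> ` L = R"
    and disj: "L \<inter> M = {}" "L \<inter> R = {}" "M \<inter> R = {}"
    and S'L: "\<And>i j. (i, j) \<in> S' \<Longrightarrow> i \<notin> L \<and> j \<notin> L"
    and S'MR: "\<And>i j. (i, j) \<in> S' \<Longrightarrow> i \<in> M \<Longrightarrow> j \<notin> R"
    and bound: "L \<union> M \<union> R \<subseteq> {..<n}"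
    and le: "index_le n S' d"
  shows "index_le n S d"
proof -
  obtain F' where F': "F' \<in> supported S'" and sep: "separated (form_kernel n S' F') d"
    using le by (auto simp: index_le_def)
  define F where "F = (\<lambda>i j. if i \<in> L then (if j = \<sigma> i then 1 else 0) else F' i j)"
  have FL: "F i j = (if j = \<sigma> i then 1 else 0)" if "i \<in> L" for i j
    using that by (simp add: F_def)
  have F0: "F i j = F' i j" if "i \<notin> L" for i j
    using that by (simp add: F_def)
  have F'0: "F' i j = 0" if "(i, j) \<notin> S'" for i j
    using supportedD[OF F'] that by blast
  have \<sigma>R: "\<sigma> l \<in> R" if "l \<in> L" for l using \<sigma> that by auto
  have Ln: "l < n" if "l \<in> L" for l using bound that by auto
  have Rn: "r < n" if "r \<in> R" for r using bound that by auto
  define T where "T = (\<lambda>(x::cmat) i j. if (i, j) \<in> S' then x i j else 0)"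
  have "separated (form_kernel n S F) d"
  proof (rule separated_transport[OF sep, where T = T])
    fix x assume x: "x \<in> form_kernel n S F"
    note eq = form_kernelD(2)[OF x]
    have x0: "x i j = 0" if "(i, j) \<notin> S" for i j
      using form_kernelD(1)[OF x] that by blast
    have xL: "x i l = 0" if "l \<in> L" "i \<notin> L" for i l
      using that S'L disj x0[of i l] by (auto simp: S)
    have rhsL: "(\<Sum>k<n. x j k * F l k) = x j (\<sigma> l)" if "l \<in> L" for j l
      using that Rn[OF \<sigma>R[OF that]] by (subst sum_single[of "\<sigma> l"]) (auto simp: FL)
    have A: "x l' l = x (\<sigma> l') (\<sigma> l)" if l: "l \<in> L" "l' \<in> L" for l l'
    proof -
      have "(\<Sum>k<n. x k l * F k (\<sigma> l')) = x l' l * F l' (\<sigma> l')"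
      proof (rule sum_single)
        fix k assume "k < n" "k \<noteq> l'"
        then show "x k l * F k (\<sigma> l') = 0"
          using l xL[of l k] \<sigma>(1) by (cases "k \<in> L") (auto simp: FL inj_on_eq_iff)
      qed (use l Ln in auto)
      moreover have "F l' (\<sigma> l') = 1" using l by (simp add: FL)
      ultimately show ?thesis
        using eq[of l "\<sigma> l'"] l \<sigma>R by (auto simp: S rhsL)
    qed
    have lhs0: "(\<Sum>k<n. x k l * F k j) = 0" if "l \<in> L" "j \<notin> R" for l j
    proof (rule sum.neutral, rule ballI)
      show "x k l * F k j = 0" for k
        using that xL[of l k] \<sigma>R[of k] by (cases "k \<in> L") (auto simp: FL)
    qed
    have B: "x m r = 0" if m: "m \<in> M" "r \<in> R" for m r
    proof -
      obtain l where l: "l \<in> L" "r = \<sigma> l" using \<sigma> m by auto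
      show ?thesis using eq[of l m] lhs0[of l m] rhsL[of l m] m l disj by (auto simp: S)
    qed
    have C: "x l r = 0" if m: "l \<in> L" "r \<in> R" for l r
    proof -
      obtain l' where l: "l' \<in> L" "r = \<sigma> l'" using \<sigma> m by auto
      show ?thesis using eq[of l' l] lhs0[of l' l] rhsL[of l' l] m l disj by (auto simp: S)
    qed
    have Tx: "T x i j = x i j" if "i \<notin> L" for i j
      using x0[of i j] that B by (auto simp: T_def S)
    show "T x \<in> form_kernel n S' F'"
    proof (rule form_kernelI)
      show "T x i j = 0" if "(i, j) \<notin> S'" for i j using that by (simp add: T_def)
      fix i j assume ij: "(i, j) \<in> S'"
      have nL: "i \<notin> L" "j \<notin> L" using S'L[OF ij] by auto
      have "x k i * F k j = T x k i * F' k j" for k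
      proof (cases "k \<in> L")
        case True
        have "x k i = 0 \<or> j \<notin> R"
          using x0[of k i] C[OF True, of i] S'MR[OF ij] nL S'L[of k i] True disj by (auto simp: S)
        moreover have "F' k j = 0" using True S'L[of k j] F'0 by blast
        ultimately show ?thesis using \<sigma>R[OF True] True by (auto simp: FL)
      qed (auto simp: Tx F0)
      moreover have "x j k * F i k = T x j k * F' i k" for k
        using nL by (simp add: Tx F0)
      ultimately show "(\<Sum>k<n. T x k i * F' k j) = (\<Sum>k<n. T x j k * F' i k)"
        using eq[of i j] ij by (simp add: S)
    qed
    assume T0: "T x = 0"
    have z: "x i j = 0" if "i \<notin> L" for i j
      using fun_cong[OF fun_cong[OF T0], of i j] Tx[OF that] by simp
    have LL: "x l l' = 0" if "l \<in> L" "l' \<in> L" for l l'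
      using A[of l' l] z[of "\<sigma> l" "\<sigma> l'"] \<sigma>R that disj by auto
    have LM: "x l m = 0" if m: "l \<in> L" "m \<in> M" for l m
    proof -
      have "(\<Sum>k<n. x k m * F k (\<sigma> l)) = x l m * F l (\<sigma> l)"
      proof (rule sum_single)
        fix k assume "k < n" "k \<noteq> l"
        then show "x k m * F k (\<sigma> l) = 0"
          using m z[of k m] \<sigma>(1) by (cases "k \<in> L") (auto simp: FL inj_on_eq_iff)
      qed (use m Ln in auto)
      moreover have "(\<Sum>k<n. x (\<sigma> l) k * F m k) = 0"
        using z[of "\<sigma> l"] \<sigma>R[OF m(1)] disj by (intro sum.neutral) auto
      ultimately show ?thesis
        using eq[of m "\<sigma> l"] m \<sigma>R by (auto simp: S FL)
    qed
    have "x i j = 0" for i j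
    proof (cases "i \<in> L")
      case True
      then show ?thesis using LL[of i j] LM[of i j] C[of i j] x0[of i j] S'L[of i j] by (auto simp: S)
    qed (rule z)
    then show "x = 0" by (simp add: fun_eq_iff)
  qed (auto simp: T_def mat_scale_def fun_eq_iff)
  moreover have "F \<in> supported S"
    using F'0 \<sigma>R by (auto simp: supported_def F_def S)
  ultimately show ?thesis by (rule index_leI[rotated])
qed

text \<open>Besides the identity in \<open>L \<times> R\<close>, the point is that
  \<open>M \<times> L\<close> takes over the part that \<open>M \<times> R\<close> has in the
  smaller algebra: \<open>F\<close> carries the values of \<open>F'\<close> on
  \<open>M \<times> R\<close> to \<open>M \<times> L\<close> and vanishes on
  \<open>M \<times> R\<close>, and \<open>T\<close> moves the entries of a kernel element back
  accordingly.\<close>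

lemma reduction_long:
  fixes S' :: "(nat \<times> nat) set"
  assumes S: "S = S' \<union> L \<times> (L \<union> M \<union> R) \<union> M \<times> L"
    and \<sigma>: "inj_on \<sigma> L" "\<sigma> ` L = R"
    and disj: "L \<inter> M = {}" "L \<inter> R = {}" "M \<inter> R = {}"
    and S'L: "\<And>i j. (i, j) \<in> S' \<Longrightarrow> i \<notin> L \<and> j \<notin> L"
    and MMR: "M \<times> (M \<union> R) \<subseteq> S'"
    and Mrow: "\<And>i j. (i, j) \<in> S' \<Longrightarrow> i \<in> M \<Longrightarrow> j \<in> M \<union> R"
    and Mcol: "\<And>i j. (i, j) \<in> S' \<Longrightarrow> j \<in> M \<Longrightarrow> i \<in> M"
    and Rrow: "\<And>i j. (i, j) \<in> S' \<Longrightarrow> i \<in> R \<Longrightarrow> j \<in> R"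
    and bound: "L \<union> M \<union> R \<subseteq> {..<n}"
    and le: "index_le n S' d"
  shows "index_le n S d"
proof -
  obtain F' where F': "F' \<in> supported S'" and sep: "separated (form_kernel n S' F') d"
    using le by (auto simp: index_le_def)
  define F where "F = (\<lambda>i j. if i \<in> L then (if j = \<sigma> i then 1 else 0)
    else if i \<in> M \<and> j \<in> L then F' i (\<sigma> j) else if i \<in> M \<and> j \<in> R then 0 else F' i j)"
  define T where "T = (\<lambda>(x::cmat) i j. if i \<in> M \<and> j \<in> R then x i (inv_into L \<sigma> j)
    else if (i, j) \<in> S' then x i j else 0)"
  have \<sigma>R: "\<sigma> l \<in> R" if "l \<in> L" for l using \<sigma> that by auto
  have R\<sigma>: "\<exists>l\<in>L. r = \<sigma> l" if "r \<in> R" for r using \<sigma> that by auto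
  have LMR: "l \<notin> M" "l \<notin> R" if "l \<in> L" for l using disj that by auto
  have MLR: "l \<notin> L" "l \<notin> R" if "l \<in> M" for l using disj that by auto
  have RLM: "l \<notin> L" "l \<notin> M" if "l \<in> R" for l using disj that by auto
  have Ln: "l < n" if "l \<in> L" for l using bound that by auto
  have Mn: "l < n" if "l \<in> M" for l using bound that by auto
  have Rn: "r < n" if "r \<in> R" for r using bound that by auto
  have FL: "F i j = (if j = \<sigma> i then 1 else 0)" if "i \<in> L" for i j
    using that by (simp add: F_def)
  have FML: "F m l = F' m (\<sigma> l)" if "m \<in> M" "l \<in> L" for m l
    using that disj by (auto simp: F_def)
  have FMR: "F m r = 0" if "m \<in> M" "r \<in> R" for m r
    using that disj by (auto simp: F_def)
  have FMM: "F m m' = F' m m'" if "m \<in> M" "m' \<in> M" for m m'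
    using that disj by (auto simp: F_def)
  have FX: "F i j = F' i j" if "i \<notin> L" "i \<notin> M" for i j
    using that by (auto simp: F_def)
  have F'0: "F' i j = 0" if "(i, j) \<notin> S'" for i j
    using supportedD[OF F'] that by blast
  have F'L: "F' i j = 0" if "i \<in> L \<or> j \<in> L" for i j
    using S'L[of i j] that F'0 by blast
  have sum\<sigma>: "(\<Sum>k\<in>L. h (\<sigma> k)) = (\<Sum>r\<in>R. h r)" for h :: "nat \<Rightarrow> complex"
    using sum.reindex[OF \<sigma>(1), of h] \<sigma>(2) by simp
  have "separated (form_kernel n S F) d"
  proof (rule separated_transport[OF sep, where T = T])
    fix x assume x: "x \<in> form_kernel n S F"
    note eq = form_kernelD(2)[OF x]
    have x0: "x i j = 0" if "(i, j) \<notin> S" for i j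
      using form_kernelD(1)[OF x] that by blast
    have xL: "x i l = 0" if "l \<in> L" "i \<notin> L" "i \<notin> M" for i l
      using that S'L[of i l] x0[of i l] by (auto simp: S)
    have xM: "x i m = 0" if "m \<in> M" "i \<notin> L" "i \<notin> M" for i m
      using that Mcol[of i m] x0[of i m] by (auto simp: S)
    have xMX: "x m i = 0" if "m \<in> M" "i \<notin> L" "i \<notin> M" "i \<notin> R" for i m
      using that Mrow[of m i] x0[of m i] disj by (auto simp: S)
    have xLX: "x m i = 0" if "m \<in> L" "i \<notin> L" "i \<notin> M" "i \<notin> R" for i m
      using that S'L[of m i] x0[of m i] disj by (auto simp: S)
    have xR: "x r i = 0" if "r \<in> R" "i \<notin> R" for i r
      using that Rrow[of r i] x0[of r i] disj by (auto simp: S)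
    have rhsL: "(\<Sum>k<n. x j k * F l k) = x j (\<sigma> l)" if "l \<in> L" for j l
      using that Rn[OF \<sigma>R[OF that]] by (subst sum_single[of "\<sigma> l"]) (auto simp: FL)
    have F1: "F l (\<sigma> l) = 1" if "l \<in> L" for l using that by (simp add: FL)
    have A: "x l' l = x (\<sigma> l') (\<sigma> l)" if l: "l \<in> L" "l' \<in> L" for l l'
    proof -
      have "(\<Sum>k<n. x k l * F k (\<sigma> l')) = x l' l * F l' (\<sigma> l')"
      proof (rule sum_single)
        fix k assume "k < n" "k \<noteq> l'"
        then show "x k l * F k (\<sigma> l') = 0"
          using l xL[of l k] \<sigma>(1) FMR[of k, OF _ \<sigma>R[OF l(2)]]
          by (cases "k \<in> L") (auto simp: FL inj_on_eq_iff)
      qed (use l Ln in auto)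
      then show ?thesis
        using eq[of l "\<sigma> l'"] l \<sigma>R by (auto simp: S rhsL F1)
    qed
    have B: "x l m = 0" if m: "l \<in> L" "m \<in> M" for l m
    proof -
      have "(\<Sum>k<n. x k m * F k (\<sigma> l)) = x l m * F l (\<sigma> l)"
      proof (rule sum_single)
        fix k assume "k < n" "k \<noteq> l"
        then show "x k m * F k (\<sigma> l) = 0"
          using m xM[of m k] \<sigma>(1) FMR[of k, OF _ \<sigma>R[OF m(1)]]
          by (cases "k \<in> L") (auto simp: FL inj_on_eq_iff)
      qed (use m Ln in auto)
      moreover have "(\<Sum>k<n. x (\<sigma> l) k * F m k) = 0"
      proof (rule sum.neutral, rule ballI)
        show "x (\<sigma> l) k * F m k = 0" for k
          using xR[OF \<sigma>R[OF m(1)], of k] FMR[OF m(2), of k] by auto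
      qed
      moreover have "(m, \<sigma> l) \<in> S" using m MMR \<sigma>R by (auto simp: S)
      ultimately show ?thesis
        using eq[of m "\<sigma> l"] m by (auto simp: F1)
    qed
    have TX: "T x i j = x i j" if "i \<notin> L" "i \<notin> M" for i j
      using x0[of i j] that by (auto simp: T_def S)
    have TL: "T x i j = 0" if "i \<in> L \<or> j \<in> L" for i j
      using that S'L[of i j] disj by (auto simp: T_def)
    have TMM: "T x i j = x i j" if "i \<in> M" "j \<in> M" for i j
      using that MMR disj by (auto simp: T_def)
    have TMR: "T x m (\<sigma> l) = x m l" if "m \<in> M" "l \<in> L" for m l
      using that \<sigma> by (auto simp: T_def)
    have TMX: "T x m i = 0" if "m \<in> M" "i \<notin> M" "i \<notin> R" for m i
      using that Mrow[of m i] by (auto simp: T_def)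
    show "T x \<in> form_kernel n S' F'"
    proof (rule form_kernelI)
      show "T x i j = 0" if "(i, j) \<notin> S'" for i j using that MMR by (auto simp: T_def)
      fix i j assume ij: "(i, j) \<in> S'"
      have nL: "i \<notin> L" "j \<notin> L" using S'L[OF ij] by auto
      consider (MR) l where "i \<in> M" "l \<in> L" "j = \<sigma> l" | (MM) "i \<in> M" "j \<in> M"
        | (RR) l l' where "l \<in> L" "i = \<sigma> l" "l' \<in> L" "j = \<sigma> l'"
        | (X) "i \<notin> L" "i \<notin> M" "i \<notin> R" "j \<notin> L" "j \<notin> M"
        using Mrow[OF ij] Rrow[OF ij] Mcol[OF ij] R\<sigma> nL by blast
      then show "(\<Sum>k<n. T x k i * F' k j) = (\<Sum>k<n. T x j k * F' i k)"
      proof cases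
        \<comment> \<open>The equation of \<open>T x\<close> at \<open>(i, \<sigma> l)\<close> is
          that of \<open>x\<close> at \<open>(i, l)\<close>, a position of
          \<open>M \<times> L\<close>. The coincidence \<open>A\<close> of the \<open>L\<close> and
          \<open>R\<close> blocks of \<open>x\<close> moves row \<open>l\<close> to row
          \<open>\<sigma> l\<close>.\<close>
        case MR
        have l: "(\<lambda>k. T x k i * F' k j) = (\<lambda>k. x k i * F k l)"
        proof
          show "T x k i * F' k j = x k i * F k l" for k
            using MR B[of k i] xM[of i k] TX[of k i]
            by (cases "k \<in> L"; cases "k \<in> M") (auto simp: F'L FML TMM)
        qed
        have "(\<Sum>k<n. x l k * F i k) = (\<Sum>k\<in>L. x (\<sigma> l) (\<sigma> k) * F' i (\<sigma> k))"
        proof (rule sum_eq_on)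
          show "x l k * F i k = x (\<sigma> l) (\<sigma> k) * F' i (\<sigma> k)" if "k \<in> L" for k
            using that MR A[of k l] by (simp add: FML)
          show "x l k * F i k = 0" if "k \<notin> L" for k
            using that MR B[of l k] FMR[of i k] xLX[of l k] by (cases "k \<in> M"; cases "k \<in> R") auto
        qed (use Ln in auto)
        also have "\<dots> = (\<Sum>r\<in>R. x (\<sigma> l) r * F' i r)" by (rule sum\<sigma>)
        also have "\<dots> = (\<Sum>k<n. T x j k * F' i k)"
        proof (rule sum_eq_on[symmetric])
          show "T x j k * F' i k = x (\<sigma> l) k * F' i k" for k
            using MR RLM[OF \<sigma>R[of l]] by (simp add: TX)
          show "T x j k * F' i k = 0" if "k \<notin> R" for k
            using MR RLM[OF \<sigma>R[of l]] xR[OF \<sigma>R[of l], of k] that by (simp add: TX)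
        qed (use Rn in auto)
        finally show ?thesis
          using eq[of i l] MR unfolding l by (simp add: S)
      next
        case MM
        have l: "(\<lambda>k. T x k i * F' k j) = (\<lambda>k. x k i * F k j)"
        proof
          show "T x k i * F' k j = x k i * F k j" for k
            using MM xM[of i k] TX[of k i] MLR[of j] \<sigma>R[of k]
            by (cases "k \<in> L"; cases "k \<in> M") (auto simp: F'L FL FMM TMM)
        qed
        have "(\<Sum>k<n. x j k * F i k) = (\<Sum>k\<in>L \<union> M. x j k * F i k)"
        proof (rule sum_eq_on)
          show "x j k * F i k = 0" if "k \<notin> L \<union> M" for k
            using that MM FMR[of i k] xMX[of j k] by (cases "k \<in> R") auto
        qed (use Ln Mn in auto)
        also have "\<dots> = (\<Sum>k\<in>L. x j k * F i k) + (\<Sum>k\<in>M. x j k * F i k)"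
          using disj bound by (intro sum.union_disjoint) (auto intro: finite_subset)
        also have "(\<Sum>k\<in>L. x j k * F i k) = (\<Sum>k\<in>L. T x j (\<sigma> k) * F' i (\<sigma> k))"
          using MM by (intro sum.cong) (auto simp: FML TMR)
        also have "\<dots> = (\<Sum>r\<in>R. T x j r * F' i r)" by (rule sum\<sigma>)
        also have "(\<Sum>k\<in>M. x j k * F i k) = (\<Sum>k\<in>M. T x j k * F' i k)"
          using MM by (intro sum.cong) (auto simp: FMM TMM)
        also have "(\<Sum>r\<in>R. T x j r * F' i r) + (\<Sum>k\<in>M. T x j k * F' i k)
            = (\<Sum>k\<in>R \<union> M. T x j k * F' i k)"
          using disj bound by (intro sum.union_disjoint[symmetric]) (auto intro: finite_subset)
        also have "\<dots> = (\<Sum>k<n. T x j k * F' i k)"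
        proof (rule sum_eq_on[symmetric])
          show "T x j k * F' i k = 0" if "k \<notin> R \<union> M" for k
            using that MM TMX[of j k] by auto
        qed (use Rn Mn in auto)
        finally show ?thesis
          using eq[of i j] ij unfolding l by (simp add: S)
      next
        case RR
        have iR: "i \<in> R" "j \<in> R" using RR \<sigma>R by auto
        \<comment> \<open>The equation of \<open>T x\<close> at
          \<open>(\<sigma> l, \<sigma> l')\<close> is the sum of those of \<open>x\<close> at
          \<open>(\<sigma> l, \<sigma> l')\<close> and at \<open>(l, l')\<close>. The subtracted
          term comes from the entry \<open>F l' (\<sigma> l') = 1\<close> and cancels the right-hand
          side \<open>x l' i\<close> of the second one.\<close>
        have p: "T x k i * F' k j = x k i * F k j + x k l * F k l' - (if k = l' then x l' i else 0)" for k
          using RR \<sigma>R[of k] xL[of l k] TX[of k i] LMR[of l'] MLR[of k] iR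
          by (cases "k \<in> L"; cases "k \<in> M")
             (auto simp: F'L FL FML FMR TMR FX inj_on_eq_iff[OF \<sigma>(1)])
        have "(\<Sum>k<n. T x k i * F' k j)
            = (\<Sum>k<n. x k i * F k j) + (\<Sum>k<n. x k l * F k l') - x l' i"
          unfolding p using Ln RR by (simp add: sum.distrib sum_subtractf)
        also have "(\<Sum>k<n. x k l * F k l') = x l' i"
          using eq[of l l'] RR rhsL by (simp add: S)
        also have "(\<Sum>k<n. x k i * F k j) = (\<Sum>k<n. x j k * F i k)"
          using eq[of i j] ij by (simp add: S)
        also have "\<dots> = (\<Sum>k<n. T x j k * F' i k)"
          using iR RLM by (simp add: TX FX)
        finally show ?thesis by simp
      next
        case X
        have l: "(\<lambda>k. T x k i * F' k j) = (\<lambda>k. x k i * F k j)"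
        proof
          show "T x k i * F' k j = x k i * F k j" for k
            using X xLX[of k i] xMX[of k i] TMX[of k i]
            by (cases "k \<in> L"; cases "k \<in> M") (auto simp: TL TX FX)
        qed
        show ?thesis
          using eq[of i j] ij X unfolding l by (simp add: S TX FX)
      qed
    qed
    assume T0: "T x = 0"
    then have T0: "T x i j = 0" for i j by simp
    have zX: "x i j = 0" if "i \<notin> L" "i \<notin> M" for i j
      using T0[of i j] TX[OF that] by simp
    have MM: "x i j = 0" if "i \<in> M" "j \<in> M" for i j
      using T0[of i j] TMM[OF that] by simp
    have x_ML: "x i j = 0" if "i \<in> M" "j \<in> L" for i j
      using T0[of i "\<sigma> j"] TMR[OF that] by simp
    have LL: "x l l' = 0" if "l \<in> L" "l' \<in> L" for l l'
      using A[of l' l] zX[of "\<sigma> l" "\<sigma> l'"] RLM[OF \<sigma>R] that by auto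
    have lhs0: "(\<Sum>k<n. x k l * F k j) = 0" if "l \<in> L" for l j
    proof (rule sum.neutral, rule ballI)
      show "x k l * F k j = 0" for k
        using that LL[of k l] x_ML[of k l] zX[of k l] by auto
    qed
    have MR: "x i j = 0" if m: "i \<in> M" "j \<in> R" for i j
    proof -
      obtain l where l: "l \<in> L" "j = \<sigma> l" using R\<sigma> m by auto
      show ?thesis using eq[of l i] lhs0[of l i] rhsL[of l i] m l by (auto simp: S)
    qed
    have LR: "x i j = 0" if m: "i \<in> L" "j \<in> R" for i j
    proof -
      obtain l where l: "l \<in> L" "j = \<sigma> l" using R\<sigma> m by auto
      show ?thesis using eq[of l i] lhs0[of l i] rhsL[of l i] m l by (auto simp: S)
    qed
    have "x i j = 0" for i j
      using zX[of i j] LL[of i j] B[of i j] LR[of i j] xLX[of i j]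
        x_ML[of i j] MM[of i j] MR[of i j] xMX[of i j] by blast
    then show "x = 0" by (simp add: fun_eq_iff)
  qed (auto simp: T_def mat_scale_def fun_eq_iff)
  moreover have "F i j = 0" if "(i, j) \<notin> S" for i j
  proof -
    have "(i, j) \<notin> S'" using that by (auto simp: S)
    then show ?thesis using that F'0 \<sigma>R by (auto simp: F_def S)
  qed
  then have "F \<in> supported S" by (auto simp: supported_def)
  ultimately show ?thesis by (rule index_leI[rotated])
qed

section \<open>Upper bounds for the index\<close>

text \<open>Semicontinuity: the same functionals keep separating. On \<open>supported S\<close>
  every entry is a combination of them and of the pairings with \<open>F\<close>. If
  \<open>x\<close> is in the perturbed kernel and they all vanish at \<open>x\<close>, its pairings
  with \<open>F\<close> equal \<open>- \<epsilon>\<close> times its pairings with \<open>E\<close>,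
  so the size \<open>m\<close> of \<open>x\<close> satisfies
  \<open>m \<le> cmod \<epsilon> * W * m\<close>.\<close>

lemma separated_perturb:
  assumes S: "finite S" and sep: "separated (form_kernel n S F) d"
  shows "\<exists>\<delta>>0. \<forall>\<epsilon>. cmod \<epsilon> < \<delta> \<longrightarrow> separated (form_kernel n S (\<lambda>i j. F i j + \<epsilon> * E i j)) d"
proof -
  obtain \<Phi> where \<Phi>: "finite \<Phi>" "card \<Phi> \<le> d" "\<forall>\<phi>\<in>\<Phi>. functional \<phi>"
     "\<forall>x\<in>form_kernel n S F. (\<forall>\<phi>\<in>\<Phi>. \<phi> x = 0) \<longrightarrow> x = 0"
    using sep unfolding separated_def by blast
  \<comment> \<open>Index set of one family that contains both the separating functionals and the
    pairings with \<open>F\<close>.\<close>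
  define I :: "((cmat \<Rightarrow> complex) + nat \<times> nat) set" where "I = Inl ` \<Phi> \<union> Inr ` S"
  define \<psi> where "\<psi> = case_sum (\<lambda>\<phi>::cmat \<Rightarrow> complex. \<phi>) (\<lambda>(i, j). pairing n F i j)"
  define Q where "Q = (\<lambda>(i, j). pairing n E i j)"
  have Q: "functional (Q s)" for s
    by (cases s) (simp add: Q_def functional_pairing)
  have "\<exists>c. \<forall>x\<in>supported S. x (fst t) (snd t) = (\<Sum>i\<in>I. c i * \<psi> i x)" for t
  proof (rule functional_in_span)
    show "functional (\<psi> i)" if "i \<in> I" for i
      using that \<Phi>(3) by (auto simp: I_def \<psi>_def functional_pairing)
    fix x assume x: "x \<in> supported S" "\<And>i. i \<in> I \<Longrightarrow> \<psi> i x = 0"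
    have "\<forall>\<phi>\<in>\<Phi>. \<phi> x = 0"
      using x(2)[of "Inl _"] by (auto simp: I_def \<psi>_def)
    moreover have "pairing n F i j x = 0" if "(i, j) \<in> S" for i j
      using x(2)[of "Inr (i, j)"] that by (auto simp: I_def \<psi>_def)
    then have "x \<in> form_kernel n S F" using x(1) by (auto simp: form_kernel_def)
    ultimately have "x = 0" using \<Phi>(4) by blast
    then show "x (fst t) (snd t) = 0" by simp
  qed (use \<Phi>(1) S in \<open>auto simp: I_def subspace_supported functional_entry\<close>)
  then obtain c where c: "\<And>t x. x \<in> supported S \<Longrightarrow> x (fst t) (snd t) = (\<Sum>i\<in>I. c t i * \<psi> i x)"
    by metis
  \<comment> \<open>Norm bound for recovering \<open>x\<close> from its pairings with
    \<open>E\<close>. The radius \<open>1 / (1 + W)\<close> below gives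
    \<open>cmod \<epsilon> * W < 1\<close> and also makes sense for \<open>W = 0\<close>.\<close>
  define W where "W = (\<Sum>t\<in>S. \<Sum>s\<in>S. cmod (c t (Inr s)) * (\<Sum>u\<in>S. cmod (Q s (unit_mat u))))"
  have W: "0 \<le> W" unfolding W_def by (intro sum_nonneg mult_nonneg_nonneg) auto
  have "separated (form_kernel n S (\<lambda>i j. F i j + \<epsilon> * E i j)) d" if \<epsilon>: "cmod \<epsilon> < 1 / (1 + W)" for \<epsilon>
    unfolding separated_def
  proof (intro exI[of _ \<Phi>] conjI ballI impI)
    fix x assume x: "x \<in> form_kernel n S (\<lambda>i j. F i j + \<epsilon> * E i j)" and z: "\<forall>\<phi>\<in>\<Phi>. \<phi> x = 0"
    have xS: "x \<in> supported S" using x form_kernel_supported by blast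
    define m where "m = (\<Sum>u\<in>S. cmod (x (fst u) (snd u)))"
    have m0: "0 \<le> m" unfolding m_def by (intro sum_nonneg) auto
    have xm: "cmod (x (fst u) (snd u)) \<le> m" if "u \<in> S" for u
      unfolding m_def using that S by (intro member_le_sum) auto
    have Qx: "cmod (Q s x) \<le> m * (\<Sum>u\<in>S. cmod (Q s (unit_mat u)))" for s
    proof -
      have "Q s x = Q s (\<Sum>u\<in>S. mat_scale (x (fst u) (snd u)) (unit_mat u))"
        using supported_expand[OF S xS] by simp
      also have "\<dots> = (\<Sum>u\<in>S. x (fst u) (snd u) * Q s (unit_mat u))"
        using Q by (simp add: functional_sum functional_scale)
      also have "cmod \<dots> \<le> (\<Sum>u\<in>S. m * cmod (Q s (unit_mat u)))"
        by (intro sum_norm_le) (auto simp: norm_mult xm mult_right_mono)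
      finally show ?thesis by (simp add: sum_distrib_left)
    qed
    have \<psi>S: "\<psi> (Inr s) x = - \<epsilon> * Q s x" if "s \<in> S" for s
    proof -
      obtain i j where s: "s = (i, j)" by (cases s)
      have "pairing n (\<lambda>i j. F i j + \<epsilon> * E i j) i j x = pairing n F i j x + \<epsilon> * pairing n E i j x"
        by (simp add: pairing_def algebra_simps sum.distrib sum_distrib_left)
      moreover have "pairing n (\<lambda>i j. F i j + \<epsilon> * E i j) i j x = 0"
        using x that s by (auto simp: form_kernel_def)
      ultimately show ?thesis by (simp add: \<psi>_def Q_def s eq_neg_iff_add_eq_0)
    qed
    have "x (fst t) (snd t) = (\<Sum>s\<in>S. c t (Inr s) * (- \<epsilon> * Q s x))" for t
    proof -
      have "x (fst t) (snd t) = (\<Sum>i\<in>I. c t i * \<psi> i x)" by (rule c[OF xS])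
      also have "\<dots> = (\<Sum>i\<in>Inl ` \<Phi>. c t i * \<psi> i x) + (\<Sum>i\<in>Inr ` S. c t i * \<psi> i x)"
        unfolding I_def using \<Phi>(1) S by (intro sum.union_disjoint) auto
      also have "(\<Sum>i\<in>Inl ` \<Phi>. c t i * \<psi> i x) = 0"
        using z by (intro sum.neutral) (auto simp: \<psi>_def)
      also have "(\<Sum>i\<in>Inr ` S. c t i * \<psi> i x) = (\<Sum>s\<in>S. c t (Inr s) * (- \<epsilon> * Q s x))"
        by (subst sum.reindex) (auto simp: \<psi>S)
      finally show ?thesis by simp
    qed
    then have "cmod (x (fst t) (snd t))
        \<le> (\<Sum>s\<in>S. cmod (c t (Inr s)) * (cmod \<epsilon> * (m * (\<Sum>u\<in>S. cmod (Q s (unit_mat u))))))" for t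
      by (simp only:) (intro sum_norm_le, simp add: norm_mult mult_left_mono Qx)
    then have "m \<le> (\<Sum>t\<in>S. \<Sum>s\<in>S. cmod (c t (Inr s)) * (cmod \<epsilon> * (m * (\<Sum>u\<in>S. cmod (Q s (unit_mat u))))))"
      unfolding m_def by (intro sum_mono) (simp add: m_def)
    also have "\<dots> = cmod \<epsilon> * m * W"
      by (simp add: W_def sum_distrib_left mult_ac)
    finally have "m \<le> cmod \<epsilon> * W * m" by (simp add: mult_ac)
    moreover have "cmod \<epsilon> * W < 1"
    proof -
      have "cmod \<epsilon> * (1 + W) < 1" using \<epsilon> W by (simp add: field_simps)
      then show ?thesis using norm_ge_zero[of \<epsilon>] by (simp only: distrib_left mult_1_right)
    qed
    ultimately have "m = 0"
      using m0 mult_less_cancel_right[of "cmod \<epsilon> * W" m 1] by linarith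
    then have "x (fst u) (snd u) = 0" if "u \<in> S" for u
      using xm[OF that] by simp
    then have "x i j = 0" for i j
      using supportedD[OF xS, of i j] by (metis fst_conv snd_conv)
    then show "x = 0" by (simp add: fun_eq_iff)
  qed (use \<Phi> in auto)
  moreover have "0 < 1 / (1 + W)" using W by simp
  ultimately show ?thesis by blast
qed

section \<open>Blocks of a composition and index patterns\<close>

fun same_block :: "nat list \<Rightarrow> nat \<Rightarrow> nat \<Rightarrow> nat \<Rightarrow> bool" where
  "same_block [] s i j \<longleftrightarrow> False"
| "same_block (p # a) s i j \<longleftrightarrow>
     s \<le> i \<and> i < s + p \<and> s \<le> j \<and> j < s + p \<or> same_block a (s + p) i j"

text \<open>Upper triangular entries are governed by the blocks of \<open>b\<close>, lower triangular ones by those of \<open>a\<close>;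
  \<open>s\<close> is the index of the first basis vector.\<close>

definition pattern :: "nat list \<Rightarrow> nat list \<Rightarrow> nat \<Rightarrow> (nat \<times> nat) set" where
  "pattern a b s = {(i, j). i \<le> j \<and> same_block b s i j \<or> j \<le> i \<and> same_block a s i j}"

lemma same_block_range: "same_block a s i j \<Longrightarrow> s \<le> i \<and> i < s + sum_list a \<and> s \<le> j \<and> j < s + sum_list a"
  by (induction a arbitrary: s) force+

lemma same_block_sym: "same_block a s i j \<longleftrightarrow> same_block a s j i"
  by (induction a arbitrary: s) auto

lemma same_block_trans: "same_block a s i j \<Longrightarrow> same_block a s j k \<Longrightarrow> same_block a s i k"
proof (induction a arbitrary: s)
  case (Cons p a)
  then show ?case using same_block_range[of a "s + p"] by auto (meson leD)+
qed simp

lemma same_block_refl: "same_block a s i i \<longleftrightarrow> s \<le> i \<and> i < s + sum_list a"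
proof (induction a arbitrary: s)
  case (Cons p a)
  show ?case by (simp only: same_block.simps Cons.IH sum_list.Cons) presburger
qed simp

lemma same_block_append:
  "same_block (a @ b) s i j \<longleftrightarrow> same_block a s i j \<or> same_block b (s + sum_list a) i j"
  by (induction a arbitrary: s) (auto simp: add.assoc)

lemma pattern_range:
  assumes "(i, j) \<in> pattern a b s" "sum_list a = sum_list b"
  shows "s \<le> i \<and> i < s + sum_list a \<and> s \<le> j \<and> j < s + sum_list a"
  using assms same_block_range[of a s i j] same_block_range[of b s i j] by (auto simp: pattern_def)

lemma pattern_transpose: "pattern b a s = (pattern a b s)\<inverse>"
  by (auto simp: pattern_def same_block_sym)

text \<open>Removing initial indices raises the offset instead of renumbering, so the surviving
  matrix entries keep their positions in all reductions.\<close>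

lemma pattern_equal:
  "pattern (p # a) (p # b) s = pattern a b (s + p) \<union> {s..<s + p} \<times> {s..<s + p}"
  by (auto simp: pattern_def)

text \<open>The shape required by \<open>reduction_short\<close>: \<open>L\<close>, \<open>M\<close>
  and \<open>R\<close> are the first \<open>p\<close>, the middle \<open>q - 2 * p\<close> and the
  last \<open>p\<close> indices of the first block of the second composition. For
  \<open>q = 2 * p\<close> the new list begins with a zero part, which \<open>pattern_0\<close>
  removes.\<close>

lemma pattern_short:
  assumes "2 * p \<le> q"
  shows "pattern (p # a) (q # b) s = pattern a ((q - 2 * p) # p # b) (s + p)
    \<union> {s..<s + p} \<times> ({s..<s + p} \<union> {s + p..<s + q - p} \<union> {s + q - p..<s + q})
    \<union> {s + p..<s + q - p} \<times> {s + q - p..<s + q}"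
proof -
  obtain r where q: "q = 2 * p + r" using assms le_Suc_ex by blast
  have e: "s + p + r + p = s + (2 * p + r)" by auto
  have "(i, j) \<in> pattern (p # a) (q # b) s \<longleftrightarrow> (i, j) \<in> pattern a ((q - 2 * p) # p # b) (s + p)
    \<union> {s..<s + p} \<times> ({s..<s + p} \<union> {s + p..<s + p + r} \<union> {s + p + r..<s + q})
    \<union> {s + p..<s + p + r} \<times> {s + p + r..<s + q}" for i j
    unfolding q pattern_def
    by (cases "same_block a (s + p) i j"; cases "same_block b (s + (2 * p + r)) i j"; auto simp: e)
  moreover have "s + q - p = s + p + r" by (simp add: q)
  ultimately show ?thesis by (simp only: set_eq_iff split_paired_All simp_thms)
qed

text \<open>Now the first \<open>p\<close> and the last \<open>p\<close> indices of the long block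
  overlap in \<open>M\<close>, or just meet if \<open>q = 2 * p\<close>. What remains on either
  side, \<open>L\<close> and \<open>R\<close>, has \<open>q - p\<close> indices.\<close>

lemma pattern_long:
  assumes "p < q" "q \<le> 2 * p"
  shows "pattern (p # a) (q # b) s = pattern ((p - (q - p)) # a) (p # b) (s + (q - p))
    \<union> {s..<s + (q - p)} \<times> ({s..<s + (q - p)} \<union> {s + (q - p)..<s + p} \<union> {s + p..<s + q})
    \<union> {s + (q - p)..<s + p} \<times> {s..<s + (q - p)}"
proof -
  obtain d where q: "q = p + d" using assms by (meson le_Suc_ex less_imp_le)
  obtain m where p: "p = d + m" using assms q by (auto dest: le_Suc_ex)
  have e: "s + d + m = s + (d + m)" "s + d + (d + m) = s + (d + m + d)" by auto
  have "(i, j) \<in> pattern (p # a) (q # b) s \<longleftrightarrow> (i, j) \<in> pattern (m # a) (p # b) (s + d)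
    \<union> {s..<s + d} \<times> ({s..<s + d} \<union> {s + d..<s + p} \<union> {s + p..<s + q})
    \<union> {s + d..<s + p} \<times> {s..<s + d}" for i j
    unfolding q p pattern_def
    by (cases "same_block a (s + (d + m)) i j"; cases "same_block b (s + (d + m + d)) i j"; auto simp: e)
  moreover have "q - p = d" "p - (q - p) = m" by (simp_all add: q p)
  ultimately show ?thesis by (simp only: set_eq_iff split_paired_All simp_thms)
qed

lemma pattern_0: "pattern a (0 # b) s = pattern a b s"
  by (auto simp: pattern_def)

text \<open>Meander arcs join positions symmetric in a part, so cutting off both ends of
  \<open>k\<close> deletes just its outermost arc. For \<open>k = 2\<close> nothing is left in the
  middle, and a zero part is not allowed in a composition.\<close>

definition one_arc :: "nat list \<Rightarrow> nat list \<Rightarrow> bool" where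
  "one_arc a b \<longleftrightarrow> (\<exists>u k v. 2 \<le> k \<and> b = u @ k # v \<and>
     a = u @ 1 # (if k = 2 then [] else [k - 2]) @ 1 # v)"

lemma one_arc_Cons: "one_arc a b \<Longrightarrow> one_arc (p # a) (p # b)"
  unfolding one_arc_def by (metis append_Cons)

section \<open>Reductions for pairs of compositions and the induction over them\<close>

lemma index_le_short:
  assumes le: "index_le n (pattern a ((q - 2 * p) # p # b) (s + p)) d"
    and pq: "2 * p \<le> q" and sum: "p + sum_list a = q + sum_list b" and n: "s + p + sum_list a \<le> n"
  shows "index_le n (pattern (p # a) (q # b) s) d"
\<comment> \<open>Any bijection from \<open>L\<close> to \<open>R\<close> would do; a translation is
  the simplest.\<close>
proof (rule reduction_short[OF pattern_short[OF pq], where \<sigma> = "\<lambda>l. l + (q - p)"])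
  show "(\<lambda>l. l + (q - p)) ` {s..<s + p} = {s + q - p..<s + q}"
    using pq image_add_atLeastLessThan'[of "q - p" s "s + p"] by (simp add: add.commute)
  fix i j assume ij: "(i, j) \<in> pattern a ((q - 2 * p) # p # b) (s + p)"
  have "s + p \<le> i \<and> s + p \<le> j"
    using pattern_range[OF ij] pq sum by simp
  then show "i \<notin> {s..<s + p} \<and> j \<notin> {s..<s + p}" by auto
next
  fix i j assume ij: "(i, j) \<in> pattern a ((q - 2 * p) # p # b) (s + p)" "i \<in> {s + p..<s + q - p}"
  have "s + p + (q - 2 * p) + p = s + q" "s + p + (q - 2 * p) = s + q - p" using pq by auto
  then show "j \<notin> {s + q - p..<s + q}"
    using ij by (auto simp: pattern_def dest!: same_block_range)
qed (use le pq sum n in \<open>auto simp: inj_on_def\<close>)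

lemma index_le_long:
  assumes le: "index_le n (pattern ((p - (q - p)) # a) (p # b) (s + (q - p))) d"
    and pq: "p < q" "q \<le> 2 * p" and sum: "p + sum_list a = q + sum_list b" and n: "s + p + sum_list a \<le> n"
  shows "index_le n (pattern (p # a) (q # b) s) d"
proof -
  let ?S = "pattern ((p - (q - p)) # a) (p # b) (s + (q - p))"
  have e: "s + (q - p) + (p - (q - p)) = s + p" "s + (q - p) + p = s + q" using pq by auto
  show ?thesis
  proof (rule reduction_long[OF pattern_long[OF pq], where \<sigma> = "\<lambda>l. l + p"])
    show "(\<lambda>l. l + p) ` {s..<s + (q - p)} = {s + p..<s + q}"
      using pq image_add_atLeastLessThan'[of p s "s + (q - p)"] by simp
    show "i \<notin> {s..<s + (q - p)} \<and> j \<notin> {s..<s + (q - p)}" if ij: "(i, j) \<in> ?S" for i j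
    proof -
      have "s + (q - p) \<le> i \<and> s + (q - p) \<le> j" using pattern_range[OF ij] pq sum by simp
      then show ?thesis by auto
    qed
    show "{s + (q - p)..<s + p} \<times> ({s + (q - p)..<s + p} \<union> {s + p..<s + q}) \<subseteq> ?S"
      using pq by (auto simp: pattern_def e)
    show "j \<in> {s + (q - p)..<s + p} \<union> {s + p..<s + q}" if "(i, j) \<in> ?S" "i \<in> {s + (q - p)..<s + p}" for i j
      using that pq by (auto simp: pattern_def e dest!: same_block_range)
    show "i \<in> {s + (q - p)..<s + p}" if "(i, j) \<in> ?S" "j \<in> {s + (q - p)..<s + p}" for i j
      using that pq by (auto simp: pattern_def e dest!: same_block_range)
    show "j \<in> {s + p..<s + q}" if "(i, j) \<in> ?S" "i \<in> {s + p..<s + q}" for i j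
      using that pq by (auto simp: pattern_def e dest!: same_block_range)
  qed (use le pq sum n in auto)
qed

text \<open>One witness for all three bounds: the step with equal first parts passes each of them
  on, and the other steps obtain a stronger bound from a weaker one for fewer indices.\<close>

definition index_gap :: "nat \<Rightarrow> nat list \<Rightarrow> nat list \<Rightarrow> nat \<Rightarrow> bool" where
  "index_gap n a b s \<longleftrightarrow> (\<exists>d. index_le n (pattern a b s) d \<and> d \<le> sum_list a \<and>
     (a \<noteq> b \<longrightarrow> d + 1 \<le> sum_list a) \<and>
     (a \<noteq> b \<and> \<not> one_arc a b \<and> \<not> one_arc b a \<longrightarrow> d + 2 \<le> sum_list a))"

lemma index_gap_swap:
  assumes "index_gap n b a s" "sum_list a = sum_list b" shows "index_gap n a b s"
  using assms index_le_transpose unfolding index_gap_def pattern_transpose[of a b] by metis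

text \<open>If \<open>2 * p \<le> q\<close>, the reduction removes \<open>p\<close> indices. This
  gives the gap 2 for \<open>p \<ge> 2\<close>, and for \<open>p = 1\<close> as soon as the reduced
  pair is unequal; an equal reduced pair with \<open>p = 1\<close> is exactly a one-arc pair.
  Otherwise \<open>q - p \<ge> 1\<close> indices disappear and the reduced pair is unequal, which
  again makes 2. The induction hypothesis is a premise so that the lemma serves both orders of the
  first parts.\<close>

lemma index_gap_less:
  assumes pq: "0 < p" "p < q" and pos: "\<forall>x\<in>set a. 0 < x" "\<forall>x\<in>set b. 0 < x"
    and sum: "p + sum_list a = q + sum_list b" and n: "s + p + sum_list a \<le> n"
    and IH: "\<And>a' b' s'. \<lbrakk>sum_list a' < p + sum_list a; \<forall>x\<in>set a'. 0 < x; \<forall>x\<in>set b'. 0 < x;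
      sum_list a' = sum_list b'; s' + sum_list a' \<le> n\<rbrakk> \<Longrightarrow> index_gap n a' b' s'"
  shows "index_gap n (p # a) (q # b) s"
proof (cases "2 * p \<le> q")
  case True
  \<comment> \<open>A zero middle part is dropped to keep the parts positive, as the induction
    hypothesis demands.\<close>
  let ?b = "(if 2 * p = q then [] else [q - 2 * p]) @ p # b"
  have sb: "sum_list a = sum_list ?b" using sum True by auto
  have "index_gap n a ?b (s + p)"
    using pq pos sum n True sb by (intro IH) auto
  then obtain d where d: "index_le n (pattern a ?b (s + p)) d" "d \<le> sum_list a"
    "a \<noteq> ?b \<Longrightarrow> d + 1 \<le> sum_list a"
    unfolding index_gap_def by blast
  have "pattern a ?b (s + p) = pattern a ((q - 2 * p) # p # b) (s + p)"
    using True by (auto simp: pattern_0)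
  then have le: "index_le n (pattern (p # a) (q # b) s) d"
    using d(1) index_le_short[OF _ True sum n] by simp
  have gap: "d + 2 \<le> p + sum_list a" if "\<not> one_arc (p # a) (q # b)"
  proof (cases "p = 1 \<and> a = ?b")
    case eq: True
    have "one_arc (p # a) (q # b)"
      unfolding one_arc_def
      by (rule exI[of _ "[]"], rule exI[of _ q], rule exI[of _ b]) (use eq True in auto)
    with that show ?thesis by blast
  next
    case False
    then show ?thesis using d(2,3) pq by linarith
  qed
  show ?thesis
    unfolding index_gap_def by (rule exI[of _ d]) (use le d pq gap in auto)
next
  case False
  let ?a = "(p - (q - p)) # a" and ?b = "p # b"
  have sb: "sum_list ?a = sum_list ?b" using sum pq False by auto
  have "index_gap n ?a ?b (s + (q - p))"
    using pq pos sum n False sb by (intro IH) auto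
  \<comment> \<open>The first parts are \<open>2 * p - q\<close> and \<open>p\<close>, which differ
    because \<open>p < q\<close>.\<close>
  moreover have "?a \<noteq> ?b" using pq by auto
  ultimately obtain d where d: "index_le n (pattern ?a ?b (s + (q - p))) d" "d + 1 \<le> sum_list ?a"
    unfolding index_gap_def by blast
  have "index_le n (pattern (p # a) (q # b) s) d"
    using index_le_long[OF d(1) pq(2) _ sum n] False by simp
  then show ?thesis
    unfolding index_gap_def by (intro exI[of _ d]) (use d(2) pq False in auto)
qed

lemma index_gap:
  assumes "\<forall>x\<in>set a. 0 < x" "\<forall>x\<in>set b. 0 < x" "sum_list a = sum_list b" "s + sum_list a \<le> n"
  shows "index_gap n a b s"
  using assms
proof (induction "sum_list a" arbitrary: a b s rule: less_induct)
  case less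
  show ?case
  proof (cases a)
    case Nil
    then have "b = []" using less.prems by (cases b) auto
    have "separated (form_kernel n {} 0) 0"
      unfolding separated_def form_kernel_def supported_def by (intro exI[of _ "{}"]) (auto simp: fun_eq_iff)
    then have "index_le n (pattern a b s) 0"
      using Nil \<open>b = []\<close> by (intro index_leI[of 0]) (auto simp: supported_def pattern_def)
    then show ?thesis using Nil \<open>b = []\<close> unfolding index_gap_def by (intro exI[of _ 0]) simp
  next
    case a: (Cons p a')
    then obtain q b' where b: "b = q # b'" using less.prems by (cases b) auto
    consider "p = q" | "p < q" | "q < p" by linarith
    then show ?thesis
    proof cases
      case 1
      have "index_gap n a' b' (s + p)"
        using less.prems a b 1 by (intro less.hyps) auto
      then obtain d where d: "index_le n (pattern a' b' (s + p)) d" "d \<le> sum_list a'"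
        "a' \<noteq> b' \<Longrightarrow> d + 1 \<le> sum_list a'"
        "a' \<noteq> b' \<Longrightarrow> \<not> one_arc a' b' \<Longrightarrow> \<not> one_arc b' a' \<Longrightarrow> d + 2 \<le> sum_list a'"
        unfolding index_gap_def by blast
      have "index_le n (pattern a' b' (s + p) \<union> {s..<s + p} \<times> {s..<s + p}) (d + card {s..<s + p})"
      proof (rule reduction_equal)
        fix i j assume ij: "(i, j) \<in> pattern a' b' (s + p)"
        have "s + p \<le> i \<and> s + p \<le> j"
          using pattern_range[OF ij] less.prems a b 1 by simp
        then show "i \<notin> {s..<s + p} \<and> j \<notin> {s..<s + p}" by auto
      qed (use less.prems a d in auto)
      then have "index_le n (pattern a b s) (d + p)"
        using a b 1 by (simp add: pattern_equal)
      then show ?thesis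
        unfolding index_gap_def using d(2-4) a b 1 one_arc_Cons
        by (intro exI[of _ "d + p"]) auto
    next
      case 2
      then show ?thesis unfolding a b using less.prems less.hyps unfolding a b
        by (intro index_gap_less) auto
    next
      case 3
      have "index_gap n b a s" unfolding a b
      proof (rule index_gap_less[OF _ 3])
        fix a'' b'' :: "nat list" and s'
        assume "sum_list a'' < q + sum_list b'" "\<forall>x\<in>set a''. 0 < x" "\<forall>x\<in>set b''. 0 < x"
          "sum_list a'' = sum_list b''" "s' + sum_list a'' \<le> n"
        then show "index_gap n a'' b'' s'"
          using less.prems by (intro less.hyps) (auto simp: a b)
      qed (use less.prems in \<open>auto simp: a b\<close>)
      then show ?thesis using less.prems(3) by (rule index_gap_swap)
    qed
  qed
qed

section \<open>Lower bounds for the index\<close>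

definition commutant :: "nat \<Rightarrow> cmat \<Rightarrow> cmat set" where
  "commutant n G = {x \<in> supported ({..<n} \<times> {..<n}).
     \<forall>i<n. \<forall>j<n. (\<Sum>k<n. G i k * x k j) = (\<Sum>k<n. x i k * G k j)}"

lemma subspace_commutant: "cmat.subspace (commutant n G)"
proof -
  define \<phi> where "\<phi> = (\<lambda>(i, j) (x::cmat). (\<Sum>k<n. x k j * G i k) - (\<Sum>k<n. x i k * G k j))"
  have "functional (\<phi> s)" for s
    by (cases s) (simp add: \<phi>_def functional_minus functional_lincomb functional_entry)
  then have "cmat.subspace {x \<in> supported ({..<n} \<times> {..<n}). \<forall>f\<in>\<phi> ` ({..<n} \<times> {..<n}). f x = 0}"
    by (intro subspace_common_zeros subspace_supported) auto
  moreover have "commutant n G = {x \<in> supported ({..<n} \<times> {..<n}). \<forall>f\<in>\<phi> ` ({..<n} \<times> {..<n}). f x = 0}"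
    by (auto simp: commutant_def \<phi>_def mult.commute)
  ultimately show ?thesis by simp
qed

text \<open>A commutator of two upper triangular matrices is strictly upper triangular. An upper
  triangular unknown therefore has \<open>n\<close> more coordinates than there are equations, those
  at the positions above the diagonal.\<close>

lemma dim_commutant_triangular:
  assumes B: "\<And>i j. j < i \<Longrightarrow> i < n \<Longrightarrow> B i j = 0"
  shows "n \<le> cmat.dim (commutant n B \<inter> supported {(i, j). i \<le> j \<and> j < n})"
proof -
  let ?U = "{(i, j). i \<le> j \<and> j < n}" and ?N = "{(i, j). i < j \<and> j < n}"
  have fin: "finite ?U" by (rule finite_subset[of _ "{..<n} \<times> {..<n}"]) auto
  then have finN: "finite ?N" by (rule finite_subset[rotated]) auto
  have U: "?U = ?N \<union> (\<lambda>i. (i, i)) ` {..<n}" by auto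
  have "card ?U = card ?N + card ((\<lambda>i. (i, i)) ` {..<n})"
    unfolding U using finN by (intro card_Un_disjoint) auto
  then have card: "card ?U = card ?N + n"
    by (simp add: card_image inj_on_def)
  define \<phi> where "\<phi> = (\<lambda>(i, j) (x::cmat). (\<Sum>k<n. x k j * B i k) - (\<Sum>k<n. x i k * B k j))"
  let ?K = "{x \<in> supported ?U. \<forall>f\<in>\<phi> ` ?N. f x = 0}"
  have \<phi>: "functional (\<phi> s)" for s
    by (cases s) (simp add: \<phi>_def functional_minus functional_lincomb functional_entry)
  have "card ?U \<le> cmat.dim ?K + card (\<phi> ` ?N)"
    using dim_le_cut[OF fin subspace_supported order_refl, of "\<phi> ` ?N"] finN \<phi>
    by (auto simp: dim_supported[OF fin])
  moreover have "card (\<phi> ` ?N) \<le> card ?N" by (rule card_image_le[OF finN])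
  ultimately have "n \<le> cmat.dim ?K" using card by linarith
  also have "?K = commutant n B \<inter> supported ?U"
  proof (intro equalityI subsetI)
    fix x assume "x \<in> commutant n B \<inter> supported ?U"
    then show "x \<in> ?K" by (auto simp: commutant_def \<phi>_def mult.commute)
  next
    fix x assume x: "x \<in> ?K"
    then have xU: "x \<in> supported ?U" by simp
    have x0: "x i j = 0" if "j < i" for i j using supportedD[OF xU, of i j] that by auto
    have "(\<Sum>k<n. B i k * x k j) = (\<Sum>k<n. x i k * B k j)" if ij: "i < n" "j < n" for i j
    proof -
      consider "i < j" | "i = j" | "j < i" by linarith
      then show ?thesis
      proof cases
        case 1
        then have "\<phi> (i, j) x = 0" using x ij by auto
        then show ?thesis by (simp add: \<phi>_def mult.commute)
      next
        case 2
        have "B i k * x k j = x i k * B k j" for k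
          using B[of k i] B[of i k] x0[of k i] x0[of i k] supportedD[OF xU, of i k] 2 ij by (cases k i rule: linorder_cases) auto
        then show ?thesis by simp
      next
        case 3
        have "B i k * x k j = 0 \<and> x i k * B k j = 0" if "k < n" for k
          using B[of k i] x0[of j k] x0[of k i] B[of j k] 3 ij that by (cases "k < i") auto
        then have "(\<Sum>k<n. B i k * x k j) = 0" "(\<Sum>k<n. x i k * B k j) = 0"
          by (auto intro!: sum.neutral)
        then show ?thesis by simp
      qed
    qed
    moreover have "supported ?U \<subseteq> supported ({..<n} \<times> {..<n})" by (rule supported_mono) auto
    ultimately show "x \<in> commutant n B \<inter> supported ?U"
      using xU by (auto simp: commutant_def)
  qed
  finally show ?thesis .
qed

text \<open>Conjugation by the matrices of a Schur decomposition embeds the triangular part of the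
  centralizer of the Schur form. \<open>m\<close> and \<open>T\<close> translate between functions
  of two indices and library matrices.\<close>

lemma dim_commutant: "n \<le> cmat.dim (commutant n G)"
proof -
  define A where "A = mat n n (\<lambda>(i, j). G i j)"
  have A: "A \<in> carrier_mat n n" by (simp add: A_def)
  obtain es where es: "char_poly A = (\<Prod>e\<leftarrow>es. [:- e, 1:])"
    using char_poly_factorized[OF A] by auto
  obtain B P Q where "schur_decomposition A es = (B, P, Q)"
    by (cases "schur_decomposition A es")
  from schur_decomposition[OF A es this]
  have sim: "similar_mat_wit A B P Q" and tri: "upper_triangular B" by auto
  note D = similar_mat_witD2[OF A sim]
  have B: "B \<in> carrier_mat n n" and P: "P \<in> carrier_mat n n" and Q: "Q \<in> carrier_mat n n"
    and PQ: "P * Q = 1\<^sub>m n" and QP: "Q * P = 1\<^sub>m n" and APQ: "A = P * B * Q"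
    using D by auto
  define m where "m = (\<lambda>x::cmat. mat n n (\<lambda>(i, j). x i j))"
  have m: "m x \<in> carrier_mat n n" for x by (simp add: m_def)
  let ?C = "\<lambda>i j. B $$ (i, j)"
  let ?U = "{(i, j). i \<le> j \<and> j < n}"
  define T where "T = (\<lambda>x i j. if i < n \<and> j < n then (P * m x * Q) $$ (i, j) else 0)"
  have "n \<le> cmat.dim (commutant n ?C \<inter> supported ?U)"
    by (rule dim_commutant_triangular) (use B tri in auto)
  also have "\<dots> \<le> cmat.dim (commutant n G)"
  proof (rule dim_le_injective[where T = T])
    show "finite ?U" by (rule finite_subset[of _ "{..<n} \<times> {..<n}"]) auto
    show "cmat.subspace (commutant n ?C \<inter> supported ?U)"
      by (intro cmat.subspace_inter subspace_commutant subspace_supported)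
    show "commutant n G \<subseteq> supported ({..<n} \<times> {..<n})" by (auto simp: commutant_def)
    show "T (x + y) = T x + T y" for x y
    proof -
      have "m (x + y) = m x + m y" by (auto simp: m_def)
      then have "P * m (x + y) * Q = P * m x * Q + P * m y * Q"
        using P Q m by (simp add: mult_add_distrib_mat[OF P m m] add_mult_distrib_mat[of _ n n _ Q n])
      then show ?thesis using P Q m[of x] m[of y] by (auto simp: T_def fun_eq_iff)
    qed
    show "T (mat_scale c x) = mat_scale c (T x)" for c x
    proof -
      have "m (mat_scale c x) = c \<cdot>\<^sub>m m x" by (auto simp: m_def mat_scale_def)
      then have "P * m (mat_scale c x) * Q = c \<cdot>\<^sub>m (P * m x * Q)"
        using P Q m by (simp add: mult_smult_distrib[OF P m] mult_smult_assoc_mat[of _ n n Q n])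
      then show ?thesis using P Q m[of x] by (auto simp: T_def fun_eq_iff mat_scale_def)
    qed
    fix x assume x: "x \<in> commutant n ?C \<inter> supported ?U"
    have "B * m x = m x * B"
      using x B by (intro eq_matI)
        (auto simp: m_def commutant_def scalar_prod_def lessThan_atLeast0 mult.commute)
    let ?X = "P * m x * Q"
    have X: "?X \<in> carrier_mat n n" using P Q m by auto
    have "A * ?X = P * B * (Q * P) * m x * Q"
      unfolding APQ using P Q B m[of x] by (simp add: assoc_mult_mat[of _ n n _ n _ n])
    also have "\<dots> = P * (B * m x) * Q"
      unfolding QP using P Q B m[of x] by (simp add: assoc_mult_mat[of _ n n _ n _ n])
    also have "\<dots> = P * m x * (Q * P) * B * Q"
      unfolding QP \<open>B * m x = m x * B\<close> using P Q B m[of x] by (simp add: assoc_mult_mat[of _ n n _ n _ n])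
    also have "\<dots> = ?X * A"
      unfolding APQ using P Q B m[of x] by (simp add: assoc_mult_mat[of _ n n _ n _ n])
    finally have AX: "A * ?X = ?X * A" .
    show "T x \<in> commutant n G"
      unfolding commutant_def
    proof (intro CollectI conjI allI impI)
      show "T x \<in> supported ({..<n} \<times> {..<n})" by (auto simp: supported_def T_def)
      fix i j assume ij: "i < n" "j < n"
      have "(A * ?X) $$ (i, j) = (\<Sum>k<n. G i k * T x k j)"
        using ij A X P Q by (simp add: scalar_prod_def lessThan_atLeast0 T_def A_def)
      moreover have "(?X * A) $$ (i, j) = (\<Sum>k<n. T x i k * G k j)"
        using ij A X P Q by (simp add: scalar_prod_def lessThan_atLeast0 T_def A_def)
      ultimately show "(\<Sum>k<n. G i k * T x k j) = (\<Sum>k<n. T x i k * G k j)" using AX by simp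
    qed
    assume T0: "T x = 0"
    have "?X $$ (i, j) = 0" if "i < n" "j < n" for i j
      using fun_cong[OF fun_cong[OF T0], of i j] that by (simp add: T_def)
    then have X0: "?X = 0\<^sub>m n n" using X by (intro eq_matI) auto
    have "m x = (Q * P) * m x * (Q * P)" unfolding QP PQ using m[of x] by simp
    also have "\<dots> = Q * ?X * P"
      using P Q m[of x] by (simp add: assoc_mult_mat[of _ n n _ n _ n])
    also have "\<dots> = 0\<^sub>m n n" unfolding X0 using P Q by simp
    finally have "m x $$ (i, j) = 0" if "i < n" "j < n" for i j using that by simp
    then have "x i j = 0" for i j
      using x supportedD[of x ?U i j] by (cases "i < n \<and> j < n") (auto simp: m_def)
    then show "x = 0" by (simp add: fun_eq_iff)
  qed auto
  finally show ?thesis .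
qed

section \<open>Equal compositions: block diagonal algebras\<close>

lemma pattern_same: "pattern a a s = {(i, j). same_block a s i j}"
  by (auto simp: pattern_def)

lemma finite_pattern: "finite (pattern a b s)"
proof (rule finite_subset)
  show "pattern a b s \<subseteq> {..<s + sum_list a + sum_list b} \<times> {..<s + sum_list a + sum_list b}"
    using same_block_range by (fastforce simp: pattern_def)
qed simp

text \<open>Shifting the diagonal blocks by widely separated scalars forces everything commuting with the
  matrix to be block diagonal, which reduces the bound to \<open>dim_commutant\<close>.\<close>

lemma dim_form_kernel_levi:
  assumes n: "sum_list a = n"
  shows "n \<le> cmat.dim (form_kernel n (pattern a a 0) F)"
proof -
  define sb where "sb = same_block a 0"
  have sb_n: "i < n" "j < n" if "sb i j" for i j
    using same_block_range[of a 0 i j] that n by (auto simp: sb_def)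
  have sb_sym: "sb i j \<longleftrightarrow> sb j i" for i j unfolding sb_def by (rule same_block_sym)
  have sb_trans: "sb i j \<Longrightarrow> sb j k \<Longrightarrow> sb i k" for i j k
    unfolding sb_def by (rule same_block_trans)
  have sb_refl: "sb i i" if "i < n" for i using that n by (simp add: sb_def same_block_refl)
  \<comment> \<open>Labels a block by its least index; labels of distinct blocks differ by at least
    1, which bounds the shift below.\<close>
  define blk where "blk = (\<lambda>i. LEAST k. sb i k)"
  have blk: "blk i = blk j \<longleftrightarrow> sb i j" if "i < n" "j < n" for i j
  proof
    assume "sb i j"
    then have "sb i = sb j" using sb_sym sb_trans by (intro ext) metis
    then show "blk i = blk j" by (simp add: blk_def)
  next
    assume eq: "blk i = blk j"
    have "sb i (blk i)" "sb j (blk j)"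
      unfolding blk_def by (rule LeastI, rule sb_refl, fact)+
    then show "sb i j" using eq sb_sym sb_trans by metis
  qed
  \<comment> \<open>Under the trace form the functional is represented by the transpose of
    \<open>F\<close>, so for block diagonal \<open>x\<close> the kernel equations say that
    \<open>x\<close> commutes with \<open>G0\<close>.\<close>
  define G0 where "G0 = (\<lambda>i j. if sb i j then F j i else 0)"
  define g where "g = (\<Sum>i<n. \<Sum>j<n. cmod (G0 i j))"
  \<comment> \<open>Summing \<open>bound\<close> over the at most \<open>n * n\<close> positions off
    the blocks gives \<open>\<tau> * M \<le> 2 * g * real (n * n) * M\<close>; the extra 1 then
    forces \<open>M = 0\<close>.\<close>
  define \<tau> where "\<tau> = 2 * g * real (n * n) + 1"
  define G where "G = (\<lambda>i j. G0 i j + (if i = j then of_real \<tau> * of_nat (blk i) else 0))"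
  have g: "0 \<le> g" unfolding g_def by (intro sum_nonneg) auto
  have \<tau>: "0 < \<tau>" unfolding \<tau>_def using g by (simp add: add_nonneg_pos)
  have comm: "(\<Sum>k<n. G0 i k * x k j) - (\<Sum>k<n. x i k * G0 k j)
      = of_real \<tau> * (of_nat (blk j) - of_nat (blk i)) * x i j"
    if x: "x \<in> commutant n G" and ij: "i < n" "j < n" for x i j
  proof -
    have "(\<Sum>k<n. G i k * x k j) = (\<Sum>k<n. G0 i k * x k j) + of_real \<tau> * of_nat (blk i) * x i j"
      using ij by (simp add: G_def distrib_right sum.distrib if_distrib[of "\<lambda>t. t * _"] cong: if_cong)
    moreover have "(\<Sum>k<n. x i k * G k j) = (\<Sum>k<n. x i k * G0 k j) + of_real \<tau> * of_nat (blk j) * x i j"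
      using ij by (simp add: G_def distrib_left sum.distrib if_distrib[of "\<lambda>t. _ * t"] mult_ac cong: if_cong)
    moreover have "(\<Sum>k<n. G i k * x k j) = (\<Sum>k<n. x i k * G k j)"
      using x ij by (simp add: commutant_def)
    ultimately show ?thesis by (simp add: algebra_simps)
  qed
  have "n \<le> cmat.dim (commutant n G)" by (rule dim_commutant)
  also have "\<dots> \<le> cmat.dim (form_kernel n (pattern a a 0) F)"
  proof (rule dim_le_injective[where T = "\<lambda>x. x"])
    fix x assume x: "x \<in> commutant n G"
    have xn: "x \<in> supported ({..<n} \<times> {..<n})" using x by (simp add: commutant_def)
    let ?O = "{(i, j). i < n \<and> j < n \<and> \<not> sb i j}"
    have finO: "finite ?O" by (rule finite_subset[of _ "{..<n} \<times> {..<n}"]) auto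
    define M where "M = (\<Sum>(i, j)\<in>?O. cmod (x i j))"
    have M: "0 \<le> M" unfolding M_def by (intro sum_nonneg) auto
    have xM: "cmod (x i j) \<le> M" if "i < n" "j < n" "\<not> sb i j" for i j
      using member_le_sum[of "(i, j)" ?O "\<lambda>(i, j). cmod (x i j)"] finO that by (auto simp: M_def)
    have gi: "(\<Sum>k<n. cmod (G0 i k)) \<le> g" if "i < n" for i
      unfolding g_def using that by (intro member_le_sum[of i "{..<n}"]) (auto intro: sum_nonneg)
    have gj: "(\<Sum>k<n. cmod (G0 k i)) \<le> g" if "i < n" for i
      unfolding g_def sum.swap[of "\<lambda>i j. cmod (G0 i j)"]
      using that by (intro member_le_sum[of i "{..<n}"]) (auto intro: sum_nonneg)
    \<comment> \<open>As \<open>G0\<close> is block diagonal, the two sums at a position off the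
      blocks involve only entries of \<open>x\<close> off the blocks, each at most
      \<open>M\<close>.\<close>
    have bound: "\<tau> * cmod (x i j) \<le> 2 * g * M" if ij: "i < n" "j < n" "\<not> sb i j" for i j
    proof -
      have "cmod (\<Sum>k<n. G0 i k * x k j) \<le> (\<Sum>k<n. cmod (G0 i k) * M)"
      proof (rule sum_norm_le)
        show "cmod (G0 i k * x k j) \<le> cmod (G0 i k) * M" if "k \<in> {..<n}" for k
        proof (cases "sb i k")
          case True
          then have "\<not> sb k j" using ij sb_trans by blast
          then show ?thesis using xM[of k j] ij that by (simp add: norm_mult mult_left_mono)
        qed (simp add: G0_def)
      qed
      also have "\<dots> \<le> g * M"
        using gi[OF ij(1)] M by (simp add: sum_distrib_right[symmetric] mult_right_mono)
      finally have 1: "cmod (\<Sum>k<n. G0 i k * x k j) \<le> g * M" .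
      have "cmod (\<Sum>k<n. x i k * G0 k j) \<le> (\<Sum>k<n. cmod (G0 k j) * M)"
      proof (rule sum_norm_le)
        show "cmod (x i k * G0 k j) \<le> cmod (G0 k j) * M" if "k \<in> {..<n}" for k
        proof (cases "sb k j")
          case True
          then have "\<not> sb i k" using ij sb_trans by blast
          then show ?thesis using xM[of i k] ij that
            by (simp add: norm_mult mult_left_mono mult.commute[of "cmod (x i k)"])
        qed (simp add: G0_def)
      qed
      also have "\<dots> \<le> g * M"
        using gj[OF ij(2)] M by (simp add: sum_distrib_right[symmetric] mult_right_mono)
      finally have 2: "cmod (\<Sum>k<n. x i k * G0 k j) \<le> g * M" .
      have "blk i \<noteq> blk j" using blk ij by simp
      then have "(1::real) \<le> \<bar>real (blk j) - real (blk i)\<bar>" by linarith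
      moreover have "cmod (of_nat (blk j) - of_nat (blk i) :: complex) = \<bar>real (blk j) - real (blk i)\<bar>"
        by (metis of_real_diff of_real_of_nat_eq norm_of_real)
      ultimately have "\<tau> * cmod (x i j)
          \<le> \<tau> * cmod (of_nat (blk j) - of_nat (blk i) :: complex) * cmod (x i j)"
        using \<tau> by (intro mult_right_mono) auto
      also have "\<dots> = cmod ((\<Sum>k<n. G0 i k * x k j) - (\<Sum>k<n. x i k * G0 k j))"
        unfolding comm[OF x ij(1,2)] using \<tau> by (simp add: norm_mult)
      also have "\<dots> \<le> g * M + g * M"
        using norm_triangle_ineq4 1 2 by (meson add_mono order_trans)
      finally show ?thesis by (simp add: mult_ac)
    qed
    have "\<tau> * M = (\<Sum>(i, j)\<in>?O. \<tau> * cmod (x i j))"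
      by (simp add: M_def sum_distrib_left case_prod_unfold)
    also have "\<dots> \<le> (\<Sum>(i, j)\<in>?O. 2 * g * M)"
      using bound by (intro sum_mono) auto
    also have "\<dots> = real (card ?O) * (2 * g * M)" by simp
    also have "\<dots> \<le> real (n * n) * (2 * g * M)"
    proof (rule mult_right_mono)
      have "card ?O \<le> card ({..<n} \<times> {..<n})" by (rule card_mono) auto
      then show "real (card ?O) \<le> real (n * n)" by (simp add: card_cartesian_product del: of_nat_mult)
    qed (use g M in auto)
    finally have "M \<le> 0" by (simp add: \<tau>_def algebra_simps)
    then have off: "x i j = 0" if "\<not> sb i j" for i j
      using xM[of i j] supportedD[OF xn, of i j] that M by (cases "i < n \<and> j < n") auto
    show "x \<in> form_kernel n (pattern a a 0) F"
    proof (rule form_kernelI)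
      show "x i j = 0" if "(i, j) \<notin> pattern a a 0" for i j
        using that off by (simp add: pattern_same sb_def)
      fix i j assume "(i, j) \<in> pattern a a 0"
      then have ij: "sb i j" by (simp add: pattern_same sb_def)
      have l: "(\<lambda>k. x k i * F k j) = (\<lambda>k. G0 j k * x k i)"
      proof
        show "x k i * F k j = G0 j k * x k i" for k
          using off[of k i] ij sb_trans[of k i j] sb_sym by (cases "sb k i") (auto simp: G0_def)
      qed
      have r: "(\<lambda>k. x j k * F i k) = (\<lambda>k. x j k * G0 k i)"
      proof
        show "x j k * F i k = x j k * G0 k i" for k
          using off[of j k] ij sb_trans[of i j k] sb_sym by (cases "sb j k") (auto simp: G0_def)
      qed
      have "(\<Sum>k<n. G0 j k * x k i) - (\<Sum>k<n. x j k * G0 k i) = 0"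
        using comm[OF x, of j i] sb_n[OF ij] blk[of j i] ij sb_sym[of i j] by simp
      then show "(\<Sum>k<n. x k i * F k j) = (\<Sum>k<n. x j k * F i k)" unfolding l r by simp
    qed
  next
    show "commutant n G \<subseteq> supported ({..<n} \<times> {..<n})" by (auto simp: commutant_def)
    show "form_kernel n (pattern a a 0) F \<subseteq> supported (pattern a a 0)" by (rule form_kernel_supported)
  qed (auto simp: subspace_commutant finite_pattern)
  finally show ?thesis .
qed

text \<open>A one-arc seaweed extends a block diagonal algebra by a Heisenberg algebra with center
  \<open>E\<^sub>l\<^sub>r\<close>. If the functional does not vanish on the center, eliminating the Heisenberg
  algebra leaves a block diagonal algebra, on which the functional becomes \<open>F'\<close> below.\<close>

lemma dim_form_kernel_heisenberg:
  assumes fin: "finite S" and S: "S = D \<union> {l} \<times> (M \<union> {r}) \<union> M \<times> {r}"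
    and disj: "l \<notin> M" "r \<notin> M" "l \<noteq> r"
    and D: "(l, l) \<in> D" "(r, r) \<in> D" "M \<times> M \<subseteq> D"
    and Dl: "\<And>i j. (i, j) \<in> D \<Longrightarrow> i = l \<longleftrightarrow> j = l"
    and Dr: "\<And>i j. (i, j) \<in> D \<Longrightarrow> i = r \<longleftrightarrow> j = r"
    and DM: "\<And>i j. (i, j) \<in> D \<Longrightarrow> i \<in> M \<longleftrightarrow> j \<in> M"
    and bound: "l < n" "r < n" "M \<subseteq> {..<n}"
    and c: "F l r \<noteq> 0"
    and F': "F' = (\<lambda>i j. F i j - (if i \<in> M \<and> j \<in> M then F i r * F l j / F l r else 0))"
  shows "cmat.dim (form_kernel n D F') \<le> cmat.dim (form_kernel n S F) + 1"
proof -
  let ?c = "F l r"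
  have finM: "finite M" using bound(3) finite_subset by blast
  have finD: "finite D" using fin by (rule finite_subset[rotated]) (auto simp: S)
  \<comment> \<open>The equation at \<open>(l, r)\<close> reads
    \<open>x l l * F l r = x r r * F l r\<close>. It is the one condition on the diagonal that the
    block diagonal algebra does not impose, hence the loss of one dimension.\<close>
  let ?\<phi> = "\<lambda>x::cmat. x l l - x r r"
  let ?K = "{x \<in> form_kernel n D F'. \<forall>\<phi>\<in>{?\<phi>}. \<phi> x = 0}"
  have "functional ?\<phi>" by (intro functional_minus functional_entry)
  then have "cmat.dim (form_kernel n D F') \<le> cmat.dim ?K + card {?\<phi>}"
    using finD by (intro dim_le_cut[OF finD subspace_form_kernel form_kernel_supported]) auto
  moreover have "cmat.dim ?K \<le> cmat.dim (form_kernel n S F)"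
  proof -
    \<comment> \<open>The entries in row \<open>l\<close> and column \<open>r\<close> are forced:
      \<open>P\<close> solves the equations at \<open>M \<times> {r}\<close>, \<open>Q\<close> those
      at \<open>{l} \<times> M\<close>, and the entry at \<open>(l, r)\<close> in \<open>T\<close>
      solves the one at \<open>(l, l)\<close>.\<close>
    define P where "P = (\<lambda>(x::cmat) m. (x r r * F m r - (\<Sum>k\<in>M. x k m * F k r)) / ?c)"
    define Q where "Q = (\<lambda>(x::cmat) m. (x l l * F l m - (\<Sum>k\<in>M. x m k * F l k)) / ?c)"
    define T where "T = (\<lambda>(x::cmat) i j. if i = l \<and> j \<in> M then P x j
      else if i \<in> M \<and> j = r then Q x i
      else if i = l \<and> j = r then - (\<Sum>k\<in>M. P x k * F l k) / ?c else x i j)"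
    have P_add: "P (x + y) = (\<lambda>m. P x m + P y m)" for x y
      by (simp add: P_def fun_eq_iff sum.distrib algebra_simps add_divide_distrib diff_divide_distrib)
    have Q_add: "Q (x + y) = (\<lambda>m. Q x m + Q y m)" for x y
      by (simp add: Q_def fun_eq_iff sum.distrib algebra_simps add_divide_distrib diff_divide_distrib)
    have P_scale: "P (mat_scale a x) = (\<lambda>m. a * P x m)" for x a
      by (simp add: P_def mat_scale_def fun_eq_iff algebra_simps sum_distrib_left diff_divide_distrib)
    have Q_scale: "Q (mat_scale a x) = (\<lambda>m. a * Q x m)" for x a
      by (simp add: Q_def mat_scale_def fun_eq_iff algebra_simps sum_distrib_left diff_divide_distrib)
    show ?thesis
    proof (rule dim_le_injective[where T = T])
      show "cmat.subspace ?K"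
        using \<open>functional ?\<phi>\<close> by (intro subspace_common_zeros subspace_form_kernel) auto
      show "?K \<subseteq> supported D" using form_kernel_supported by auto
      show "form_kernel n S F \<subseteq> supported S" by (rule form_kernel_supported)
      show "T (x + y) = T x + T y" for x y
        by (auto simp: T_def P_add Q_add fun_eq_iff sum.distrib algebra_simps add_divide_distrib diff_divide_distrib)
      show "T (mat_scale a x) = mat_scale a (T x)" for a x
      proof (intro ext)
        show "T (mat_scale a x) i j = mat_scale a (T x) i j" for i j
          unfolding T_def P_scale Q_scale by (auto simp: mat_scale_def sum_distrib_left mult.assoc)
      qed
      fix x assume "x \<in> ?K"
      then have x: "x \<in> form_kernel n D F'" and xlr: "x l l = x r r" by auto
      have x0: "x i j = 0" if "(i, j) \<notin> D" for i j using form_kernelD(1)[OF x that] .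
      have Tlm: "T x l m = P x m" if "m \<in> M" for m using that by (simp add: T_def)
      have Tmr: "T x m r = Q x m" if "m \<in> M" for m using that disj by (auto simp: T_def)
      have Tlr: "T x l r = - (\<Sum>k\<in>M. P x k * F l k) / ?c" using disj by (simp add: T_def)
      have TD: "T x i j = x i j" if "i \<noteq> l \<or> j = l" "j \<noteq> r \<or> i = r" for i j
      proof -
        have "\<not> (i = l \<and> j \<in> M)" "\<not> (i \<in> M \<and> j = r)" "\<not> (i = l \<and> j = r)"
          using that disj by blast+
        then show ?thesis by (simp only: T_def if_False)
      qed
      have T0: "T x i j = 0" if "(i, j) \<notin> S" for i j
      proof -
        have "\<not> (i = l \<and> j \<in> M)" "\<not> (i \<in> M \<and> j = r)" "\<not> (i = l \<and> j = r)" "(i, j) \<notin> D"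
          using that by (auto simp only: S)
        then show ?thesis by (simp only: T_def if_False) (rule x0)
      qed
      have colL: "(\<Sum>k<n. T x k l * h k) = x l l * h l" for h
      proof -
        have "(\<Sum>k<n. T x k l * h k) = T x l l * h l"
        proof (rule sum_single[OF bound(1)])
          fix k assume "k \<noteq> l"
          then have "(k, l) \<notin> S" using Dl[of k l] disj by (auto simp: S)
          then show "T x k l * h k = 0" by (simp add: T0)
        qed
        then show ?thesis using disj by (simp add: TD)
      qed
      have rowR: "(\<Sum>k<n. T x r k * h k) = x r r * h r" for h
      proof -
        have "(\<Sum>k<n. T x r k * h k) = T x r r * h r"
        proof (rule sum_single[OF bound(2)])
          fix k assume "k \<noteq> r"
          then have "(r, k) \<notin> S" using Dr[of r k] disj by (auto simp: S)
          then show "T x r k * h k = 0" by (simp add: T0)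
        qed
        then show ?thesis using disj by (simp add: TD)
      qed
      have colM: "(\<Sum>k<n. T x k m * h k) = P x m * h l + (\<Sum>k\<in>M. x k m * h k)" if m: "m \<in> M" for m h
      proof -
        have "(\<Sum>k<n. T x k m * h k) = (\<Sum>k\<in>insert l M. T x k m * h k)"
        proof (rule sum_eq_on)
          show "T x k m * h k = 0" if "k \<notin> insert l M" for k
            using that m T0[of k m] DM[of k m] disj by (auto simp: S)
        qed (use bound in auto)
        also have "\<dots> = P x m * h l + (\<Sum>k\<in>M. x k m * h k)"
          using finM disj m by (auto simp: Tlm intro!: sum.cong TD)
        finally show ?thesis .
      qed
      have rowM: "(\<Sum>k<n. T x m k * h k) = Q x m * h r + (\<Sum>k\<in>M. x m k * h k)" if m: "m \<in> M" for m h
      proof -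
        have "(\<Sum>k<n. T x m k * h k) = (\<Sum>k\<in>insert r M. T x m k * h k)"
        proof (rule sum_eq_on)
          show "T x m k * h k = 0" if "k \<notin> insert r M" for k
            using that m T0[of m k] DM[of m k] disj by (auto simp: S)
        qed (use bound in auto)
        also have "\<dots> = Q x m * h r + (\<Sum>k\<in>M. x m k * h k)"
          using finM disj m by (auto simp: Tmr intro!: sum.cong TD)
        finally show ?thesis .
      qed
      have rowL: "(\<Sum>k<n. T x l k * h k) = x l l * h l + ((\<Sum>k\<in>M. P x k * h k) + T x l r * h r)" for h
      proof -
        have "(\<Sum>k<n. T x l k * h k) = (\<Sum>k\<in>insert l (insert r M). T x l k * h k)"
        proof (rule sum_eq_on)
          show "T x l k * h k = 0" if "k \<notin> insert l (insert r M)" for k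
            using that T0[of l k] Dl[of l k] disj by (auto simp: S)
        qed (use bound in auto)
        also have "\<dots> = x l l * h l + ((\<Sum>k\<in>M. P x k * h k) + T x l r * h r)"
          using finM disj by (auto simp: Tlm TD intro!: sum.cong)
        finally show ?thesis .
      qed
      have colR: "(\<Sum>k<n. T x k r * h k) = x r r * h r + ((\<Sum>k\<in>M. Q x k * h k) + T x l r * h l)" for h
      proof -
        have "(\<Sum>k<n. T x k r * h k) = (\<Sum>k\<in>insert r (insert l M). T x k r * h k)"
        proof (rule sum_eq_on)
          show "T x k r * h k = 0" if "k \<notin> insert r (insert l M)" for k
            using that T0[of k r] Dr[of k r] disj by (auto simp: S)
        qed (use bound in auto)
        also have "\<dots> = x r r * h r + ((\<Sum>k\<in>M. Q x k * h k) + T x l r * h l)"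
          using finM disj by (auto simp: Tmr TD intro!: sum.cong)
        finally show ?thesis .
      qed
      \<comment> \<open>The equations at \<open>(l, l)\<close> and \<open>(r, r)\<close> both
        determine the entry at \<open>(l, r)\<close>; this is their compatibility.\<close>
      have PQ: "(\<Sum>k\<in>M. P x k * F l k) = (\<Sum>k\<in>M. Q x k * F k r)"
      proof -
        have "(\<Sum>m\<in>M. \<Sum>k\<in>M. x k m * F k r * F l m) = (\<Sum>m\<in>M. \<Sum>k\<in>M. x m k * F l k * F m r)"
          by (subst sum.swap) (simp add: mult_ac)
        moreover have "P x k * F l k = (x r r * F k r * F l k - (\<Sum>m\<in>M. x m k * F m r * F l k)) / ?c" for k
          by (simp add: P_def left_diff_distrib sum_distrib_right)
        moreover have "Q x k * F k r = (x r r * F k r * F l k - (\<Sum>m\<in>M. x k m * F l m * F k r)) / ?c" for k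
        proof -
          have "Q x k * F k r = (x r r * F l k * F k r - (\<Sum>m\<in>M. x k m * F l m * F k r)) / ?c"
            by (simp add: Q_def xlr left_diff_distrib sum_distrib_right)
          then show ?thesis by (simp only: mult.assoc mult.commute[of "F l k" "F k r"])
        qed
        ultimately show ?thesis
          by (simp only: sum_divide_distrib[symmetric] sum_subtractf)
      qed
      show "T x \<in> form_kernel n S F"
      proof (rule form_kernelI)
        show "T x i j = 0" if "(i, j) \<notin> S" for i j using T0 that .
        fix i j assume ij: "(i, j) \<in> S"
        consider (ll) "i = l" "j = l" | (lm) "i = l" "j \<in> M" | (lr) "i = l" "j = r"
          | (mr) "i \<in> M" "j = r" | (rr) "i = r" "j = r" | (mm) "i \<in> M" "j \<in> M"
          | (X) "(i, j) \<in> D" "i \<notin> {l, r}" "i \<notin> M" "j \<notin> {l, r}" "j \<notin> M"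
          using ij Dl[of i j] Dr[of i j] DM[of i j] by (auto simp: S)
        then show "(\<Sum>k<n. T x k i * F k j) = (\<Sum>k<n. T x j k * F i k)"
        proof cases
          case ll
          then show ?thesis using c by (simp add: colL rowL Tlr)
        next
          case lm
          then show ?thesis using c by (simp add: colL rowM Q_def)
        next
          case lr
          then show ?thesis by (simp add: colL rowR xlr)
        next
          case mr
          then show ?thesis using c by (simp add: colM rowR P_def)
        next
          case rr
          then show ?thesis using c by (simp add: colR rowR Tlr PQ)
        next
          case mm
          \<comment> \<open>Inserting \<open>P\<close> and \<open>Q\<close> into the equation at
            \<open>(i, j)\<close> produces the rank-one correction in \<open>F'\<close>, a Schur
            complement with pivot \<open>F l r\<close>.\<close>
          have l: "(\<Sum>k<n. x k i * F' k j) = (\<Sum>k\<in>M. x k i * (F k j - F k r * F l j / ?c))"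
          proof (rule sum_eq_on)
            show "x k i * F' k j = 0" if "k \<notin> M" for k
              using that mm x0[of k i] DM[of k i] by auto
          qed (use mm bound in \<open>auto simp: F'\<close>)
          have r: "(\<Sum>k<n. x j k * F' i k) = (\<Sum>k\<in>M. x j k * (F i k - F i r * F l k / ?c))"
          proof (rule sum_eq_on)
            show "x j k * F' i k = 0" if "k \<notin> M" for k
              using that mm x0[of j k] DM[of j k] by auto
          qed (use mm bound in \<open>auto simp: F'\<close>)
          have eq: "(\<Sum>k\<in>M. x k i * (F k j - F k r * F l j / ?c)) = (\<Sum>k\<in>M. x j k * (F i k - F i r * F l k / ?c))"
            using form_kernelD(2)[OF x, of i j] mm D(3) unfolding l r by auto
          have "(\<Sum>k\<in>M. x k i * (F k j - F k r * F l j / ?c))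
              = (\<Sum>k\<in>M. x k i * F k j - x k i * F k r * F l j / ?c)"
            by (intro sum.cong) (simp_all add: right_diff_distrib)
          moreover have "(\<Sum>k\<in>M. x j k * (F i k - F i r * F l k / ?c))
              = (\<Sum>k\<in>M. x j k * F i k - x j k * F l k * F i r / ?c)"
            by (intro sum.cong) (simp_all add: right_diff_distrib)
          ultimately have "(\<Sum>k\<in>M. x k i * F k j) - (\<Sum>k\<in>M. x k i * F k r) * F l j / ?c
              = (\<Sum>k\<in>M. x j k * F i k) - (\<Sum>k\<in>M. x j k * F l k) * F i r / ?c"
            using eq by (simp only: sum_subtractf sum_distrib_right sum_divide_distrib)
          then have "P x i * F l j + (\<Sum>k\<in>M. x k i * F k j) = Q x j * F i r + (\<Sum>k\<in>M. x j k * F i k)"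
            using c by (simp add: P_def Q_def xlr field_simps)
          then show ?thesis
            unfolding colM[OF mm(1), of "\<lambda>k. F k j"] rowM[OF mm(2), of "\<lambda>k. F i k"] .
        next
          case X
          have l: "(\<lambda>k. T x k i * F k j) = (\<lambda>k. x k i * F' k j)"
          proof
            show "T x k i * F k j = x k i * F' k j" for k
              using X by (simp add: T_def F')
          qed
          have r: "(\<lambda>k. T x j k * F i k) = (\<lambda>k. x j k * F' i k)"
          proof
            show "T x j k * F i k = x j k * F' i k" for k
              using X by (simp add: T_def F')
          qed
          show ?thesis using form_kernelD(2)[OF x X(1)] unfolding l r .
        qed
      qed
      assume z: "T x = 0"
      have "x i j = 0" for i j
      proof (cases "(i, j) \<in> D")
        case True
        then show ?thesis
          using fun_cong[OF fun_cong[OF z], of i j] TD[of i j] Dl[OF True] Dr[OF True] by auto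
      qed (rule x0)
      then show "x = 0" by (simp add: fun_eq_iff)
    qed (use fin finD in auto)
  qed
  ultimately show ?thesis by simp
qed

text \<open>\<open>U\<close> and \<open>V\<close> stand for the blocks to the left and right. The
  lower triangle of the middle block, from the fine composition, and its upper triangle, from the
  coarse one, reassemble a full block; the only further entries are in row \<open>l\<close> and
  column \<open>r\<close>.\<close>

lemma triangle_split:
  fixes i j l r :: nat
  assumes "l < r"
  shows "i \<le> j \<and> (U \<or> i \<in> {l..r} \<and> j \<in> {l..r} \<or> V) \<or>
      j \<le> i \<and> (U \<or> i = l \<and> j = l \<or> i \<in> {l + 1..<r} \<and> j \<in> {l + 1..<r} \<or> i = r \<and> j = r \<or> V)
    \<longleftrightarrow> ((U \<or> i = l \<and> j = l \<or> i \<in> {l + 1..<r} \<and> j \<in> {l + 1..<r} \<or> i = r \<and> j = r \<or> V) \<or>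
      i = l \<and> (j \<in> {l + 1..<r} \<or> j = r)) \<or> i \<in> {l + 1..<r} \<and> j = r"
  using assms by (cases "i \<le> j"; auto)

lemma dim_form_kernel_one_arc:
  assumes arc: "one_arc a b" and sum: "sum_list a = n"
  shows "n \<le> cmat.dim (form_kernel n (pattern a b 0) F) + 1"
proof -
  obtain u k v where k: "2 \<le> k" and b: "b = u @ k # v"
    and a: "a = u @ 1 # (if k = 2 then [] else [k - 2]) @ 1 # v"
    using arc by (auto simp: one_arc_def)
  define l r where "l = sum_list u" and "r = l + k - 1"
  let ?M = "{l + 1..<r}"
  have lr: "l < r" "r < n" "l + k = r + 1" "Suc l + (k - 2) = r" using k sum by (auto simp: a l_def r_def)
  have sa: "same_block a 0 i j \<longleftrightarrow> same_block u 0 i j \<or> i = l \<and> j = l \<or> i \<in> ?M \<and> j \<in> ?M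
      \<or> i = r \<and> j = r \<or> same_block v (r + 1) i j" for i j
  proof -
    have one: "s \<le> i \<and> i < s + 1 \<and> s \<le> j \<and> j < s + 1 \<longleftrightarrow> i = s \<and> j = s" for s by auto
    have u: "same_block a 0 i j \<longleftrightarrow> same_block u 0 i j \<or>
        same_block (1 # (if k = 2 then [] else [k - 2]) @ 1 # v) l i j"
      by (simp add: a same_block_append l_def)
    show ?thesis
    proof (cases "k = 2")
      case True
      have "r = l + 1" using lr(3) True by simp
      then show ?thesis
        unfolding u using True by (simp only: if_True append.simps same_block.simps one) auto
    next
      case False
      have "l + 1 + (k - 2) = r" using lr(4) by simp
      then show ?thesis
        unfolding u using False
        by (simp only: if_False append.simps same_block.simps one atLeastLessThan_iff conj_assoc)
    qed
  qed
  have sb: "same_block b 0 i j \<longleftrightarrow> same_block u 0 i j \<or> i \<in> {l..r} \<and> j \<in> {l..r}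
      \<or> same_block v (r + 1) i j" for i j
    using lr(3) by (simp add: b same_block_append l_def[symmetric] less_Suc_eq_le)
  have ur: "i < l \<and> j < l" if "same_block u 0 i j" for i j
    using same_block_range[OF that] by (simp add: l_def)
  have vr: "r < i \<and> r < j" if "same_block v (r + 1) i j" for i j
    using same_block_range[OF that] by simp
  let ?D = "pattern a a 0" and ?S = "pattern a b 0"
  have S: "?S = ?D \<union> {l} \<times> (?M \<union> {r}) \<union> ?M \<times> {r}"
  proof -
    have "(i, j) \<in> ?S \<longleftrightarrow> (i, j) \<in> ?D \<union> {l} \<times> (?M \<union> {r}) \<union> ?M \<times> {r}" for i j
      unfolding pattern_same unfolding pattern_def mem_Collect_eq prod.case sa sb Un_iff mem_Sigma_iff
        singleton_iff
      by (rule triangle_split[OF lr(1)])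
    then show ?thesis by (simp only: set_eq_iff split_paired_All simp_thms)
  qed
  have bnd: "n \<le> cmat.dim (form_kernel n ?S G) + 1" if "G l r \<noteq> 0" for G
  proof -
    let ?G = "\<lambda>i j. G i j - (if i \<in> ?M \<and> j \<in> ?M then G i r * G l j / G l r else 0)"
    have "n \<le> cmat.dim (form_kernel n ?D ?G)"
      using sum by (rule dim_form_kernel_levi)
    also have "\<dots> \<le> cmat.dim (form_kernel n ?S G) + 1"
    proof (rule dim_form_kernel_heisenberg[OF finite_pattern S])
      show "i = l \<longleftrightarrow> j = l" "i = r \<longleftrightarrow> j = r" "i \<in> ?M \<longleftrightarrow> j \<in> ?M" if "(i, j) \<in> ?D" for i j
        using that ur[of i j] vr[of i j] lr(1) by (auto simp: pattern_same sa)
    qed (use lr(1,2) that in \<open>auto simp: pattern_same sa\<close>)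
    finally show ?thesis .
  qed
  show ?thesis
  proof (cases "F l r = 0")
    case True
    let ?d = "cmat.dim (form_kernel n ?S F)"
    let ?E = "unit_mat (l, r)"
    have "separated (form_kernel n ?S F) ?d"
      by (rule separated_dim[OF finite_pattern form_kernel_supported])
    then obtain \<delta> :: real where \<delta>: "\<delta> > 0"
      and sep: "\<And>\<epsilon>. cmod \<epsilon> < \<delta> \<Longrightarrow> separated (form_kernel n ?S (\<lambda>i j. F i j + \<epsilon> * ?E i j)) ?d"
      using separated_perturb[OF finite_pattern] by blast
    \<comment> \<open>A small multiple of the matrix unit at \<open>(l, r)\<close> makes the value
      on the center nonzero, and by \<open>separated_perturb\<close> it does not increase the kernel
      dimension.\<close>
    let ?G = "\<lambda>i j. F i j + of_real (\<delta> / 2) * ?E i j"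
    have "cmat.dim (form_kernel n ?S ?G) \<le> ?d"
      by (rule dim_le_separated[OF finite_pattern subspace_form_kernel form_kernel_supported], rule sep)
        (use \<delta> in simp)
    moreover have "n \<le> cmat.dim (form_kernel n ?S ?G) + 1"
      by (rule bnd) (use True \<delta> in \<open>simp add: unit_mat_def\<close>)
    ultimately show ?thesis by simp
  qed (rule bnd)
qed

section \<open>The index of a seaweed algebra\<close>

definition trace_zero :: "nat \<Rightarrow> cmat set" where
  "trace_zero n = {x. (\<Sum>i<n. x i i) = 0}"

lemma functional_trace: "functional (\<lambda>x. \<Sum>i<n. x i i)"
  by (simp add: functional_iff mat_scale_def sum.distrib sum_distrib_left)

lemma preserves_coord_span:
  "preserves n X (coord_span A) \<longleftrightarrow> (\<forall>r c. r \<notin> A \<and> c \<in> A \<and> c < n \<longrightarrow> X r c = 0)"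
proof
  assume L: "preserves n X (coord_span A)"
  show "\<forall>r c. r \<notin> A \<and> c \<in> A \<and> c < n \<longrightarrow> X r c = 0"
  proof (intro allI impI)
    fix r c assume rc: "r \<notin> A \<and> c \<in> A \<and> c < n"
    let ?v = "\<lambda>k. if k = c then 1 else 0 :: complex"
    have "mat_vec n X ?v \<in> coord_span A"
      using L rc by (auto simp: preserves_def coord_span_def)
    then have "mat_vec n X ?v r = 0" using rc by (simp add: coord_span_def)
    moreover have "mat_vec n X ?v r = X r c"
      using rc by (simp add: mat_vec_def if_distrib[of "\<lambda>t. _ * t"] cong: if_cong)
    ultimately show "X r c = 0" by simp
  qed
next
  assume R: "\<forall>r c. r \<notin> A \<and> c \<in> A \<and> c < n \<longrightarrow> X r c = 0"
  show "preserves n X (coord_span A)"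
    unfolding preserves_def
  proof
    fix v assume v: "v \<in> coord_span A"
    have "mat_vec n X v r = 0" if "r \<notin> A" for r
      unfolding mat_vec_def
    proof (rule sum.neutral, rule ballI)
      fix c assume "c \<in> {..<n}"
      then show "X r c * v c = 0"
        using R v that by (cases "c \<in> A") (auto simp: coord_span_def)
    qed
    then show "mat_vec n X v \<in> coord_span A" by (auto simp: coord_span_def)
  qed
qed

text \<open>The flags jump at partial sums, so this translates their conditions into blocks. If
  \<open>c\<close> is in the first block, the cut to look at is the end of that block; otherwise the
  block can be removed.\<close>

lemma cut_between_iff:
  assumes "s \<le> c" "r < s + sum_list a"
  shows "(\<exists>i\<le>length a. c < s + sum_list (take i a) \<and> s + sum_list (take i a) \<le> r)
    \<longleftrightarrow> c < r \<and> \<not> same_block a s c r"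
  using assms
proof (induction a arbitrary: s)
  case (Cons p a)
  have split: "(\<exists>i\<le>length (p # a). P (s + sum_list (take i (p # a))))
      \<longleftrightarrow> P s \<or> (\<exists>i\<le>length a. P (s + p + sum_list (take i a)))" for P
  proof
    assume "\<exists>i\<le>length (p # a). P (s + sum_list (take i (p # a)))"
    then obtain i where i: "i \<le> length (p # a)" "P (s + sum_list (take i (p # a)))" by blast
    then show "P s \<or> (\<exists>i\<le>length a. P (s + p + sum_list (take i a)))"
      by (cases i) (auto simp: add.assoc)
  next
    assume "P s \<or> (\<exists>i\<le>length a. P (s + p + sum_list (take i a)))"
    then show "\<exists>i\<le>length (p # a). P (s + sum_list (take i (p # a)))"
    proof
      assume "P s"
      then show ?thesis by (intro exI[of _ 0]) simp
    next
      assume "\<exists>i\<le>length a. P (s + p + sum_list (take i a))"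
      then obtain i where "i \<le> length a" "P (s + p + sum_list (take i a))" by blast
      then show ?thesis by (intro exI[of _ "Suc i"]) (simp add: add.assoc)
    qed
  qed
  show ?case
  proof (cases "s + p \<le> c")
    case True
    then have "(\<exists>i\<le>length a. c < s + p + sum_list (take i a) \<and> s + p + sum_list (take i a) \<le> r)
        \<longleftrightarrow> c < r \<and> \<not> same_block a (s + p) c r"
      using Cons.prems by (intro Cons.IH) auto
    then show ?thesis
      using split[of "\<lambda>t. c < t \<and> t \<le> r"] True Cons.prems by simp
  next
    case False
    then have "\<not> same_block a (s + p) c r" using same_block_range by blast
    moreover have "(\<exists>i\<le>length a. c < s + p + sum_list (take i a) \<and> s + p + sum_list (take i a) \<le> r)
        \<longleftrightarrow> s + p \<le> r"
    proof
      assume "s + p \<le> r"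
      then show "\<exists>i\<le>length a. c < s + p + sum_list (take i a) \<and> s + p + sum_list (take i a) \<le> r"
        using False by (intro exI[of _ 0]) simp
    qed auto
    ultimately show ?thesis
      using split[of "\<lambda>t. c < t \<and> t \<le> r"] False Cons.prems by auto
  qed
qed simp

text \<open>The increasing flag kills the entries below the diagonal that a partial sum of
  \<open>a\<close> separates, the decreasing flag those above the diagonal that a partial sum of
  \<open>b\<close> separates.\<close>

lemma seaweed_eq:
  assumes "sum_list a = n" "sum_list b = n"
  shows "seaweed n a b = supported (pattern a b 0) \<inter> trace_zero n"
proof -
  have flagA: "(\<forall>i\<in>{1..length a}. preserves n X (coord_span {0..<sum_list (take i a)}))
      \<longleftrightarrow> (\<forall>r<n. \<forall>c<r. \<not> same_block a 0 r c \<longrightarrow> X r c = 0)" if X: "X \<in> sl n" for X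
  proof -
    have "(\<forall>i\<in>{1..length a}. preserves n X (coord_span {0..<sum_list (take i a)}))
        \<longleftrightarrow> (\<forall>r<n. \<forall>c<n. (\<exists>i\<le>length a. c < sum_list (take i a) \<and> sum_list (take i a) \<le> r) \<longrightarrow> X r c = 0)"
      (is "?L \<longleftrightarrow> ?R")
    proof
      assume ?L
      show ?R
      proof (intro allI impI)
        fix r c assume "c < n" "\<exists>i\<le>length a. c < sum_list (take i a) \<and> sum_list (take i a) \<le> r"
        then obtain i where i: "i \<le> length a" "c < sum_list (take i a)" "sum_list (take i a) \<le> r" by blast
        then have "i \<in> {1..length a}" by (cases i) auto
        then have "preserves n X (coord_span {0..<sum_list (take i a)})" using \<open>?L\<close> by blast
        then show "X r c = 0" unfolding preserves_coord_span using i \<open>c < n\<close> by simp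
      qed
    next
      assume R: ?R
      show ?L
        unfolding preserves_coord_span
      proof (intro ballI allI impI)
        fix i r c
        assume "i \<in> {1..length a}"
          and rc: "r \<notin> {0..<sum_list (take i a)} \<and> c \<in> {0..<sum_list (take i a)} \<and> c < n"
        then have "\<exists>i\<le>length a. c < sum_list (take i a) \<and> sum_list (take i a) \<le> r"
          by (intro exI[of _ i]) simp
        then show "X r c = 0" using R rc X by (cases "r < n") (auto simp: sl_def)
      qed
    qed
    also have "\<dots> \<longleftrightarrow> (\<forall>r<n. \<forall>c<n. c < r \<and> \<not> same_block a 0 c r \<longrightarrow> X r c = 0)"
      using cut_between_iff[of 0 _ _ a, unfolded add_0] assms by simp
    also have "\<dots> \<longleftrightarrow> (\<forall>r<n. \<forall>c<r. \<not> same_block a 0 r c \<longrightarrow> X r c = 0)"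
    proof (intro iffI allI impI)
      fix r c assume H: "\<forall>r<n. \<forall>c<n. c < r \<and> \<not> same_block a 0 c r \<longrightarrow> X r c = 0"
        and rc: "r < n" "c < r" "\<not> same_block a 0 r c"
      have "\<not> same_block a 0 c r" using rc(3) by (subst same_block_sym)
      then show "X r c = 0" using H rc(1,2) by simp
    next
      fix r c assume H: "\<forall>r<n. \<forall>c<r. \<not> same_block a 0 r c \<longrightarrow> X r c = 0"
        and rc: "r < n" "c < n" "c < r \<and> \<not> same_block a 0 c r"
      have "\<not> same_block a 0 r c" using rc(3) by (subst same_block_sym) simp
      then show "X r c = 0" using H rc by simp
    qed
    finally show ?thesis .
  qed
  have flagB: "(\<forall>i\<in>{0..length b}. preserves n X (coord_span {sum_list (take i b)..<n}))
      \<longleftrightarrow> (\<forall>c<n. \<forall>r<c. \<not> same_block b 0 r c \<longrightarrow> X r c = 0)" if X: "X \<in> sl n" for X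
  proof -
    have "(\<forall>i\<in>{0..length b}. preserves n X (coord_span {sum_list (take i b)..<n}))
        \<longleftrightarrow> (\<forall>c<n. \<forall>r<n. (\<exists>i\<le>length b. r < sum_list (take i b) \<and> sum_list (take i b) \<le> c) \<longrightarrow> X r c = 0)"
      (is "?L \<longleftrightarrow> ?R")
    proof
      assume ?L
      show ?R
      proof (intro allI impI)
        fix c r assume "c < n" "\<exists>i\<le>length b. r < sum_list (take i b) \<and> sum_list (take i b) \<le> c"
        then obtain i where i: "i \<le> length b" "r < sum_list (take i b)" "sum_list (take i b) \<le> c" by blast
        then have "preserves n X (coord_span {sum_list (take i b)..<n})" using \<open>?L\<close> by simp
        then show "X r c = 0" unfolding preserves_coord_span using i \<open>c < n\<close> by simp
      qed
    next
      assume R: ?R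
      show ?L
        unfolding preserves_coord_span
      proof (intro ballI allI impI)
        fix i r c
        assume "i \<in> {0..length b}"
          and rc: "r \<notin> {sum_list (take i b)..<n} \<and> c \<in> {sum_list (take i b)..<n} \<and> c < n"
        then have "r < n \<Longrightarrow> \<exists>i\<le>length b. r < sum_list (take i b) \<and> sum_list (take i b) \<le> c"
          by (intro exI[of _ i]) auto
        then show "X r c = 0" using R rc X by (cases "r < n") (auto simp: sl_def)
      qed
    qed
    also have "\<dots> \<longleftrightarrow> (\<forall>c<n. \<forall>r<n. r < c \<and> \<not> same_block b 0 r c \<longrightarrow> X r c = 0)"
      using cut_between_iff[of 0 _ _ b, unfolded add_0] assms by simp
    finally show ?thesis by (meson less_trans)
  qed
  show ?thesis
  proof (intro equalityI subsetI)
    fix X assume X: "X \<in> seaweed n a b"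
    then have sl: "X \<in> sl n" by (simp add: seaweed_def)
    have "X r c = 0" if rc: "(r, c) \<notin> pattern a b 0" for r c
    proof (cases "r < n \<and> c < n")
      case True
      have "\<not> same_block a 0 r c \<and> c \<le> r \<or> \<not> same_block b 0 r c \<and> r \<le> c"
        using rc by (cases "r \<le> c") (auto simp: pattern_def)
      moreover have "r \<noteq> c" using rc True assms by (auto simp: pattern_def same_block_refl)
      ultimately show ?thesis
        using X flagA[OF sl] flagB[OF sl] True unfolding seaweed_def by (auto simp: le_less)
    next
      case False
      then show ?thesis using sl by (auto simp: sl_def)
    qed
    then show "X \<in> supported (pattern a b 0) \<inter> trace_zero n"
      using sl by (auto simp: supported_def trace_zero_def sl_def)
  next
    fix X assume X: "X \<in> supported (pattern a b 0) \<inter> trace_zero n"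
    have X0: "X i j = 0" if "(i, j) \<notin> pattern a b 0" for i j
      using X supportedD that by blast
    have "X i j = 0" if "n \<le> i \<or> n \<le> j" for i j
      using X0[of i j] pattern_range[of i j a b 0] assms that by fastforce
    then have sl: "X \<in> sl n" using X by (auto simp: sl_def trace_zero_def)
    moreover have "\<forall>r<n. \<forall>c<r. \<not> same_block a 0 r c \<longrightarrow> X r c = 0"
      using X0 by (auto simp: pattern_def)
    moreover have "\<forall>c<n. \<forall>r<c. \<not> same_block b 0 r c \<longrightarrow> X r c = 0"
      using X0 by (auto simp: pattern_def)
    ultimately show "X \<in> seaweed n a b"
      using flagA[OF sl] flagB[OF sl] by (simp add: seaweed_def)
  qed
qed

section \<open>Between trace zero matrices and the extended algebra\<close>

lemma functional_bracket:
  assumes "functional f" shows "functional (\<lambda>y. f (mat_bracket n x y))"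
proof -
  have add: "mat_bracket n x (y + z) = mat_bracket n x y + mat_bracket n x z" for y z
    by (simp add: fun_eq_iff mat_bracket_def mat_mult_def algebra_simps sum.distrib)
  have scale: "mat_bracket n x (mat_scale c y) = mat_scale c (mat_bracket n x y)" for c y
    by (simp add: fun_eq_iff mat_bracket_def mat_mult_def mat_scale_def algebra_simps sum_distrib_left)
  show ?thesis using assms by (simp add: functional_iff add scale)
qed

lemma functional_bracket_unit:
  assumes f: "functional f" and x: "x \<in> supported ({..<n} \<times> {..<n})" and ij: "i < n" "j < n"
  shows "f (mat_bracket n x (unit_mat (i, j))) = pairing n (\<lambda>i j. f (unit_mat (i, j))) i j x"
proof -
  have "mat_bracket n x (unit_mat (i, j)) = (\<Sum>k<n. mat_scale (x k i) (unit_mat (k, j)))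
      - (\<Sum>k<n. mat_scale (x j k) (unit_mat (i, k)))"
  proof (intro ext)
    fix r c
    have x0: "x r c = 0" if "\<not> (r < n \<and> c < n)" for r c using supportedD[OF x, of r c] that by auto
    have "(\<Sum>k<n. x r k * unit_mat (i, j) k c) = (if c = j then x r i else 0)"
      using ij by (simp add: unit_mat_def if_distrib[of "\<lambda>t. _ * t"] cong: if_cong)
    moreover have "(\<Sum>k<n. unit_mat (i, j) r k * x k c) = (if r = i then x j c else 0)"
      using ij by (simp add: unit_mat_def if_distrib[of "\<lambda>t. t * _"] cong: if_cong)
    moreover have "(\<Sum>k<n. mat_scale (x k i) (unit_mat (k, j)) r c) = (if c = j then x r i else 0)"
      using x0[of r i] by (simp add: unit_mat_def mat_scale_def if_distrib[of "\<lambda>t. _ * t"] cong: if_cong)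
    moreover have "(\<Sum>k<n. mat_scale (x j k) (unit_mat (i, k)) r c) = (if r = i then x j c else 0)"
      using x0[of j c] by (simp add: unit_mat_def mat_scale_def if_distrib[of "\<lambda>t. _ * t"] cong: if_cong)
    ultimately show "mat_bracket n x (unit_mat (i, j)) r c
        = ((\<Sum>k<n. mat_scale (x k i) (unit_mat (k, j))) - (\<Sum>k<n. mat_scale (x j k) (unit_mat (i, k)))) r c"
      by (simp add: mat_bracket_def mat_mult_def sum_fun_apply)
  qed
  then show ?thesis
    using f by (simp add: functional_diff functional_sum functional_scale pairing_def)
qed

abbreviation radical :: "nat \<Rightarrow> cmat set \<Rightarrow> (cmat \<Rightarrow> complex) \<Rightarrow> cmat set" where
  "radical n g f \<equiv> {x \<in> g. \<forall>y\<in>g. f (mat_bracket n x y) = 0}"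

lemma lie_index_le: "functional f \<Longrightarrow> lie_index n g \<le> cmat.dim (radical n g f)"
  unfolding lie_index_def functional_def by (rule Least_le) blast

lemma lie_index_attained:
  obtains f where "functional f" "cmat.dim (radical n g f) = lie_index n g"
proof -
  have "functional (\<lambda>x. x 0 0)" by (rule functional_entry)
  then have "\<exists>k f. functional f \<and> cmat.dim (radical n g f) = k" by blast
  from LeastI_ex[OF this] show thesis
    using that unfolding lie_index_def functional_def by blast
qed

text \<open>The trace zero elements of the kernel on the extended algebra lie in the radical of the
  restricted form, and passing to them costs at most one dimension.\<close>

lemma lie_index_ge:
  assumes S: "S \<subseteq> {..<n} \<times> {..<n}" and m: "\<And>F. m \<le> cmat.dim (form_kernel n S F)"
  shows "m \<le> lie_index n (supported S \<inter> trace_zero n) + 1"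
proof -
  have fin: "finite S" using S finite_subset by blast
  let ?g = "supported S \<inter> trace_zero n"
  obtain f where f: "functional f" "cmat.dim (radical n ?g f) = lie_index n ?g"
    by (rule lie_index_attained)
  define F where "F = (\<lambda>i j. f (unit_mat (i, j)))"
  let ?t = "\<lambda>x::cmat. \<Sum>i<n. x i i"
  let ?K = "{x \<in> form_kernel n S F. \<forall>\<phi>\<in>{?t}. \<phi> x = 0}"
  have "m \<le> cmat.dim (form_kernel n S F)" by (rule m)
  also have "\<dots> \<le> cmat.dim ?K + card {?t}"
    using functional_trace by (intro dim_le_cut[OF fin subspace_form_kernel form_kernel_supported]) auto
  also have "cmat.dim ?K \<le> cmat.dim (radical n ?g f)"
  proof (rule dim_le_injective[where T = "\<lambda>x. x"])
    show "cmat.subspace ?K"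
      using functional_trace by (intro subspace_common_zeros subspace_form_kernel) auto
    show "?K \<subseteq> supported S" using form_kernel_supported by auto
    show "radical n ?g f \<subseteq> supported S" by auto
    fix x assume x: "x \<in> ?K"
    then have xS: "x \<in> supported S" using form_kernel_supported by auto
    have "f (mat_bracket n x y) = 0" if y: "y \<in> supported S" for y
    proof -
      let ?\<phi> = "\<lambda>y. f (mat_bracket n x y)"
      note \<phi> = functional_bracket[OF f(1), of n x]
      have "?\<phi> (unit_mat s) = 0" if "s \<in> S" for s
      proof -
        obtain i j where s: "s = (i, j)" by (cases s)
        have "x \<in> supported ({..<n} \<times> {..<n})" using xS supported_mono[OF S] by blast
        then have "?\<phi> (unit_mat s) = pairing n F i j x"
          unfolding s F_def using that S s by (intro functional_bracket_unit[OF f(1)]) auto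
        then show ?thesis using x that s by (auto simp: form_kernel_def)
      qed
      moreover have "?\<phi> y = (\<Sum>s\<in>S. y (fst s) (snd s) * ?\<phi> (unit_mat s))"
        by (subst (1) supported_expand[OF fin y])
          (simp only: functional_sum[OF \<phi>] functional_scale[OF \<phi>])
      ultimately show ?thesis by simp
    qed
    then show "x \<in> radical n ?g f" using x xS by (auto simp: trace_zero_def)
  qed (use fin in auto)
  finally show ?thesis using f by simp
qed

text \<open>Bracketing with the identity \<open>I\<close> gives 0, so an element of the radical is
  orthogonal to the whole extended algebra as well. The extended kernel contains the radical and
  also \<open>I\<close>, which is independent of it because its trace is
  \<open>n \<noteq> 0\<close>.\<close>

lemma lie_index_le_separated:
  assumes n: "0 < n" and S: "S \<subseteq> {..<n} \<times> {..<n}" "\<And>i. i < n \<Longrightarrow> (i, i) \<in> S" and le: "index_le n S d"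
  shows "lie_index n (supported S \<inter> trace_zero n) + 1 \<le> d"
proof -
  have fin: "finite S" using S finite_subset by blast
  let ?g = "supported S \<inter> trace_zero n"
  obtain F where sep: "separated (form_kernel n S F) d" using le by (auto simp: index_le_def)
  define f where "f = (\<lambda>x::cmat. \<Sum>s\<in>{..<n} \<times> {..<n}. x (fst s) (snd s) * F (fst s) (snd s))"
  have f: "functional f" unfolding f_def by (intro functional_lincomb functional_entry)
  have f_unit: "f (unit_mat (i, j)) = F i j" if "i < n" "j < n" for i j
  proof -
    have "f (unit_mat (i, j)) = (\<Sum>s\<in>{..<n} \<times> {..<n}. if s = (i, j) then F i j else 0)"
      unfolding f_def by (intro sum.cong) (auto simp: unit_mat_def)
    then show ?thesis using that by simp
  qed
  define I :: cmat where "I = (\<lambda>i j. if i = j \<and> i < n then 1 else 0)"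
  let ?K = "radical n ?g f"
  have sub: "?K \<subseteq> form_kernel n S F"
  proof
    fix x assume x: "x \<in> ?K"
    then have xn: "x \<in> supported ({..<n} \<times> {..<n})" using supported_mono[OF S(1)] by blast
    have xI: "mat_bracket n x I = 0"
    proof (intro ext)
      fix r c
      have "(\<Sum>k<n. x r k * I k c) = x r c"
        using supportedD[OF xn, of r c]
        by (cases "c < n") (auto simp: I_def if_distrib[of "\<lambda>t. _ * t"] cong: if_cong intro!: sum.neutral)
      moreover have "(\<Sum>k<n. I r k * x k c) = x r c"
        using supportedD[OF xn, of r c]
        by (cases "r < n") (auto simp: I_def if_distrib[of "\<lambda>t. t * _"] cong: if_cong intro!: sum.neutral)
      ultimately show "mat_bracket n x I r c = 0 r c" by (simp add: mat_bracket_def mat_mult_def)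
    qed
    have "pairing n F i j x = 0" if ij: "(i, j) \<in> S" for i j
    proof -
      have ijn: "i < n" "j < n" using ij S by auto
      let ?\<phi> = "\<lambda>y. f (mat_bracket n x y)"
      note \<phi> = functional_bracket[OF f, of n x]
      \<comment> \<open>Diagonal matrix units have trace 1; subtracting \<open>I / n\<close> makes
        the trace zero without changing the bracket with \<open>x\<close>.\<close>
      define y where "y = unit_mat (i, j) - mat_scale (if i = j then 1 / of_nat n else 0) I"
      have "y \<in> supported S"
        using ij S by (auto simp: y_def supported_def unit_mat_def mat_scale_def I_def)
      moreover have "(\<Sum>k<n. y k k) = 0"
      proof -
        have "(\<Sum>k<n. unit_mat (i, j) k k) = (\<Sum>k<n. if k = i then (if i = j then 1 else 0) else 0)"
          by (intro sum.cong) (auto simp: unit_mat_def)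
        also have "\<dots> = (if i = j then 1 else 0)" using ijn by simp
        finally have "(\<Sum>k<n. unit_mat (i, j) k k) = (if i = j then 1 else 0)" .
        moreover have "(\<Sum>k<n. I k k) = of_nat n" by (simp add: I_def)
        ultimately show ?thesis
          using n by (simp add: y_def mat_scale_def sum_subtractf sum_distrib_left[symmetric])
      qed
      ultimately have "?\<phi> y = 0" using x by (auto simp: trace_zero_def)
      moreover have "?\<phi> I = 0" using xI f by (simp add: functional_0)
      then have "?\<phi> y = ?\<phi> (unit_mat (i, j))"
        unfolding y_def functional_diff[OF \<phi>] functional_scale[OF \<phi>] by simp
      moreover have "?\<phi> (unit_mat (i, j)) = pairing n F i j x"
        unfolding functional_bracket_unit[OF f xn ijn] pairing_def using ijn f_unit by simp
      ultimately show ?thesis by simp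
    qed
    then show "x \<in> form_kernel n S F" using x by (auto simp: form_kernel_def)
  qed
  have "I \<in> form_kernel n S F"
  proof (rule form_kernelI)
    show "I i j = 0" if "(i, j) \<notin> S" for i j using S that by (auto simp: I_def)
    fix i j assume "(i, j) \<in> S"
    then have "i < n" "j < n" using S by auto
    then show "(\<Sum>k<n. I k i * F k j) = (\<Sum>k<n. I j k * F i k)"
      by (simp add: I_def if_distrib[of "\<lambda>t. t * _"] cong: if_cong)
  qed
  obtain B where B: "B \<subseteq> ?K" "cmat.independent B" "?K \<subseteq> cmat.span B" "card B = cmat.dim ?K" "finite B"
  proof (rule finite_basis[OF fin])
    show "?K \<subseteq> supported S" by auto
  qed
  have tr: "cmat.subspace (trace_zero n)"
    unfolding trace_zero_def
    using subspace_common_zeros[OF cmat.subspace_UNIV, of "{\<lambda>x. \<Sum>i<n. x i i}"] functional_trace by simp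
  then have "cmat.span B \<subseteq> trace_zero n" using B(1) by (intro cmat.span_minimal) auto
  moreover have "I \<notin> trace_zero n" using n by (simp add: trace_zero_def I_def)
  ultimately have I: "I \<notin> cmat.span B" by blast
  then have "I \<notin> B" using cmat.span_base by blast
  then have indep: "cmat.independent (insert I B)" using B(2) I by (simp add: cmat.independent_insert)
  obtain B' where B': "B' \<subseteq> form_kernel n S F" "cmat.independent B'" "form_kernel n S F \<subseteq> cmat.span B'"
     "card B' = cmat.dim (form_kernel n S F)" "finite B'"
    by (rule finite_basis[OF fin form_kernel_supported])
  have "insert I B \<subseteq> cmat.span B'"
    using \<open>I \<in> form_kernel n S F\<close> B(1) sub B'(3) by blast
  then have "card (insert I B) \<le> cmat.dim (form_kernel n S F)"
    using cmat.independent_span_bound[OF B'(5) indep] B'(4) by simp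
  also have "\<dots> \<le> d" by (rule dim_le_separated[OF fin subspace_form_kernel form_kernel_supported sep])
  finally have "cmat.dim ?K + 1 \<le> d" using \<open>I \<notin> B\<close> B by simp
  then show ?thesis using lie_index_le[OF f, of n ?g] by linarith
qed

text \<open>Makes \<open>one_arc\<close> irreflexive and asymmetric, so the two orders of a pair are
  never confused in the count.\<close>

lemma one_arc_length: "one_arc a b \<Longrightarrow> length b < length a"
  by (auto simp: one_arc_def)

text \<open>The value \<open>n - 2\<close> corresponds to extended index \<open>n - 1\<close>. For
  \<open>a = b\<close> the extended index is at least \<open>n\<close>, for one-arc pairs both
  bounds meet at \<open>n - 1\<close>, and otherwise the gap keeps it at most
  \<open>n - 2\<close>.\<close>

lemma lie_index_eq_iff:
  assumes n: "2 \<le> n" and a: "a \<in> compositions n" and b: "b \<in> compositions n"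
  shows "int (lie_index n (seaweed n a b)) = int n - 2 \<longleftrightarrow> one_arc a b \<or> one_arc b a"
proof -
  let ?S = "pattern a b 0" and ?i = "lie_index n (seaweed n a b)"
  have sum: "sum_list a = n" "sum_list b = n" using a b by (auto simp: compositions_def)
  note g = seaweed_eq[OF sum]
  have S: "?S \<subseteq> {..<n} \<times> {..<n}" using pattern_range[of _ _ a b 0] sum by auto
  have diag: "(i, i) \<in> ?S" if "i < n" for i
    using that sum by (simp add: pattern_def same_block_refl)
  have "index_gap n a b 0" using a b by (intro index_gap) (auto simp: compositions_def)
  then obtain d where d: "index_le n ?S d" "a \<noteq> b \<Longrightarrow> d + 1 \<le> n"
    "a \<noteq> b \<Longrightarrow> \<not> one_arc a b \<Longrightarrow> \<not> one_arc b a \<Longrightarrow> d + 2 \<le> n"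
    unfolding index_gap_def sum by blast
  have id: "?i + 1 \<le> d" unfolding g by (rule lie_index_le_separated[OF _ S diag d(1)]) (use n in auto)
  consider "one_arc a b \<or> one_arc b a" | "a = b" "\<not> one_arc a b" | "a \<noteq> b" "\<not> one_arc a b" "\<not> one_arc b a"
    by blast
  then show ?thesis
  proof cases
    case 1
    have "n \<le> cmat.dim (form_kernel n ?S F) + 1" for F
      using 1
    proof
      assume "one_arc b a"
      then have "n \<le> cmat.dim (form_kernel n (pattern b a 0) (\<lambda>i j. F j i)) + 1"
        by (rule dim_form_kernel_one_arc[OF _ sum(2)])
      also have "\<dots> \<le> cmat.dim (form_kernel n ?S F) + 1"
        using dim_transpose[OF finite_pattern, of n a b 0 F] by (simp add: pattern_transpose[of b a])
      finally show ?thesis .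
    qed (rule dim_form_kernel_one_arc[OF _ sum(1)])
    then have "n - 1 \<le> ?i + 1" unfolding g by (intro lie_index_ge[OF S]) (simp add: le_diff_conv)
    moreover have "a \<noteq> b" using 1 one_arc_length by blast
    ultimately show ?thesis using 1 id d(2) n by linarith
  next
    case 2
    have "n \<le> ?i + 1"
      unfolding g using dim_form_kernel_levi[OF sum(1)] 2(1) by (intro lie_index_ge[OF S]) simp
    then show ?thesis using 2 by auto
  next
    case 3
    then show ?thesis using id d(3) by linarith
  qed
qed

section \<open>Counting\<close>

lemma compositions_0: "compositions 0 = {[]}"
  by (auto simp: compositions_def) (metis list.set_intros(1) neq_Nil_conv less_irrefl)

lemma compositions_Suc:
  "compositions (Suc n) = (\<lambda>(p, a). p # a) ` (SIGMA p:{1..Suc n}. compositions (Suc n - p))"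
proof (intro equalityI subsetI)
  fix a assume a: "a \<in> compositions (Suc n)"
  then obtain p a' where "a = p # a'" by (cases a) (auto simp: compositions_def)
  with a show "a \<in> (\<lambda>(p, a). p # a) ` (SIGMA p:{1..Suc n}. compositions (Suc n - p))"
    by (intro image_eqI[of _ _ "(p, a')"]) (auto simp: compositions_def)
qed (auto simp: compositions_def)

lemma finite_compositions: "finite (compositions n)"
proof (induction n rule: less_induct)
  case (less n)
  then show ?case
    by (cases n) (auto simp: compositions_0 compositions_Suc intro!: finite_imageI finite_SigmaI)
qed

lemma sum_diff_reindex:
  fixes h :: "nat \<Rightarrow> nat"
  assumes "k \<le> Suc n"
  shows "(\<Sum>p\<in>{k..n}. h (n - p)) = (\<Sum>m<Suc n - k. h m)"
  by (rule sum.reindex_bij_witness[where i = "\<lambda>m. n - m" and j = "\<lambda>p. n - p"]) (use assms in auto)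

lemma card_compositions_rec: "card (compositions (Suc n)) = (\<Sum>m<Suc n. card (compositions m))"
proof -
  have "card (compositions (Suc n)) = card (SIGMA p:{1..Suc n}. compositions (Suc n - p))"
    unfolding compositions_Suc by (rule card_image) (auto simp: inj_on_def)
  also have "\<dots> = (\<Sum>p\<in>{1..Suc n}. card (compositions (Suc n - p)))"
    by (intro card_SigmaI) (auto simp: finite_compositions)
  also have "\<dots> = (\<Sum>m<Suc n. card (compositions m))" by (subst sum_diff_reindex) auto
  finally show ?thesis .
qed

lemma card_compositions: "card (compositions (Suc n)) = 2 ^ n"
proof (induction n)
  case 0
  then show ?case by (simp add: card_compositions_rec compositions_0)
next
  case (Suc n)
  have "card (compositions (Suc (Suc n))) = (\<Sum>m<Suc n. card (compositions m)) + card (compositions (Suc n))"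
    unfolding card_compositions_rec[of "Suc n"] by simp
  then show ?case using Suc card_compositions_rec[of n] by simp
qed

section \<open>Pairs differing by one arc\<close>

definition one_arc_pairs :: "nat \<Rightarrow> (nat list \<times> nat list) set" where
  "one_arc_pairs n = {(a, b). a \<in> compositions n \<and> b \<in> compositions n \<and> one_arc a b}"

lemma finite_one_arc_pairs: "finite (one_arc_pairs n)"
  by (rule finite_subset[of _ "compositions n \<times> compositions n"])
    (auto simp: one_arc_pairs_def finite_compositions)

abbreviation split_part :: "nat \<Rightarrow> nat list" where
  "split_part k \<equiv> 1 # (if k = 2 then [] else [k - 2]) @ [1]"

lemma one_arc_Cons_iff:
  "one_arc a (q # b) \<longleftrightarrow> (\<exists>a'. a = q # a' \<and> one_arc a' b) \<or> 2 \<le> q \<and> a = split_part q @ b"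
proof
  assume "one_arc a (q # b)"
  then obtain u k v where uv: "2 \<le> k" "q # b = u @ k # v"
    "a = u @ 1 # (if k = 2 then [] else [k - 2]) @ 1 # v"
    unfolding one_arc_def by blast
  then show "(\<exists>a'. a = q # a' \<and> one_arc a' b) \<or> 2 \<le> q \<and> a = split_part q @ b"
  proof (cases u)
    case (Cons p u')
    then have "one_arc (u' @ 1 # (if k = 2 then [] else [k - 2]) @ 1 # v) b"
      unfolding one_arc_def using uv by (intro exI[of _ u'] exI[of _ k] exI[of _ v]) auto
    then show ?thesis using uv Cons by auto
  qed auto
next
  assume "(\<exists>a'. a = q # a' \<and> one_arc a' b) \<or> 2 \<le> q \<and> a = split_part q @ b"
  then show "one_arc a (q # b)"
  proof
    assume "2 \<le> q \<and> a = split_part q @ b"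
    then show ?thesis
      unfolding one_arc_def by (intro exI[of _ "[]"] exI[of _ q] exI[of _ b]) auto
  qed (auto intro: one_arc_Cons)
qed

lemma not_one_arc_Nil: "\<not> one_arc a []"
  by (auto simp: one_arc_def)

lemma one_arc_pairs_Suc:
  "one_arc_pairs (Suc n) =
     (\<lambda>(p, a, b). (p # a, p # b)) ` (SIGMA p:{1..Suc n}. one_arc_pairs (Suc n - p)) \<union>
     (\<lambda>(k, v). (split_part k @ v, k # v)) ` (SIGMA k:{2..Suc n}. compositions (Suc n - k))"
  (is "_ = ?A \<union> ?B")
proof (intro equalityI subsetI)
  fix ab assume ab: "ab \<in> one_arc_pairs (Suc n)"
  then obtain a b where ab_eq: "ab = (a, b)" and a: "a \<in> compositions (Suc n)"
    and b: "b \<in> compositions (Suc n)" and arc: "one_arc a b" by (auto simp: one_arc_pairs_def)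
  obtain q b' where q: "b = q # b'" using arc not_one_arc_Nil by (cases b) auto
  from arc consider a' where "a = q # a'" "one_arc a' b'" | "2 \<le> q" "a = split_part q @ b'"
    unfolding q one_arc_Cons_iff by blast
  then show "ab \<in> ?A \<union> ?B"
  proof cases
    case 1
    then have "ab \<in> ?A"
      using a b q unfolding ab_eq
      by (intro image_eqI[of _ _ "(q, a', b')"]) (auto simp: one_arc_pairs_def compositions_def)
    then show ?thesis ..
  next
    case 2
    then have "ab \<in> ?B"
      using b q unfolding ab_eq
      by (intro image_eqI[of _ _ "(q, b')"]) (auto simp: compositions_def)
    then show ?thesis ..
  qed
next
  fix ab assume "ab \<in> ?A \<union> ?B"
  then show "ab \<in> one_arc_pairs (Suc n)"
  proof
    assume "ab \<in> ?A"
    then show ?thesis by (auto simp: one_arc_pairs_def compositions_def one_arc_Cons)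
  next
    assume "ab \<in> ?B"
    then obtain k v where "ab = (split_part k @ v, k # v)" "2 \<le> k" "k \<le> Suc n" "v \<in> compositions (Suc n - k)"
      by auto
    then show ?thesis by (auto simp: one_arc_pairs_def compositions_def one_arc_Cons_iff)
  qed
qed

text \<open>Either the merged part comes after the first part, or it is the first part of the second
  composition; in the latter case \<open>k \<ge> 2\<close> leaves at most \<open>n - 1\<close> for
  the rest.\<close>

lemma card_one_arc_pairs_rec:
  "card (one_arc_pairs (Suc n)) = (\<Sum>m<Suc n. card (one_arc_pairs m)) + (\<Sum>m<n. card (compositions m))"
proof -
  let ?A = "SIGMA p:{1..Suc n}. one_arc_pairs (Suc n - p)"
  let ?B = "SIGMA k:{2..Suc n}. compositions (Suc n - k)"
  let ?f = "\<lambda>(p, a, b). (p # a, p # b)" and ?g = "\<lambda>(k, v). (split_part k @ v, k # v)"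
  have fin: "finite ?A" "finite ?B"
    by (intro finite_SigmaI finite_one_arc_pairs finite_compositions; simp)+
  \<comment> \<open>The first parts of the two lists agree on one side; on the other they are 1 and
    \<open>k \<ge> 2\<close>.\<close>
  have "?f ` ?A \<inter> ?g ` ?B = {}" by auto
  then have "card (one_arc_pairs (Suc n)) = card (?f ` ?A) + card (?g ` ?B)"
    unfolding one_arc_pairs_Suc using fin by (intro card_Un_disjoint) auto
  also have "card (?f ` ?A) = card ?A" by (rule card_image) (auto simp: inj_on_def)
  also have "card ?A = (\<Sum>p\<in>{1..Suc n}. card (one_arc_pairs (Suc n - p)))"
    by (intro card_SigmaI) (auto simp: finite_one_arc_pairs)
  also have "\<dots> = (\<Sum>m<Suc n. card (one_arc_pairs m))" by (subst sum_diff_reindex) auto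
  also have "card (?g ` ?B) = card ?B" by (rule card_image) (auto simp: inj_on_def)
  also have "card ?B = (\<Sum>k\<in>{2..Suc n}. card (compositions (Suc n - k)))"
    by (intro card_SigmaI) (auto simp: finite_compositions)
  also have "\<dots> = (\<Sum>m<n. card (compositions m))" by (subst sum_diff_reindex) auto
  finally show ?thesis .
qed

text \<open>The factor 2 avoids the exponent \<open>n - 1\<close> and is the factor by which the two
  orders of a pair enter the final count.\<close>

lemma card_one_arc_pairs: "2 * card (one_arc_pairs (n + 2)) = (n + 2) * 2 ^ n"
proof -
  have "one_arc_pairs 0 = {}"
    by (auto simp: one_arc_pairs_def compositions_0 not_one_arc_Nil)
  then have 1: "card (one_arc_pairs (Suc 0)) = 0" by (simp add: card_one_arc_pairs_rec)
  \<comment> \<open>The difference of two consecutive instances of the summed recursion.\<close>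
  have rec: "card (one_arc_pairs (Suc (Suc m))) = 2 * card (one_arc_pairs (Suc m)) + card (compositions m)" for m
    using card_one_arc_pairs_rec[of m] unfolding card_one_arc_pairs_rec[of "Suc m"] by simp
  show ?thesis
  proof (induction n)
    case 0
    then show ?case using rec[of 0] 1 by (simp add: compositions_0 numeral_2_eq_2)
  next
    case (Suc n)
    have "2 * card (one_arc_pairs (Suc n + 2)) = 2 * (2 * card (one_arc_pairs (n + 2))) + 2 * 2 ^ n"
      using rec[of "Suc n"] by (simp add: card_compositions)
    then show ?case using Suc by (simp add: algebra_simps)
  qed
qed

theorem mainTheorem2:
  fixes n :: nat
  assumes "2 \<le> n"
  shows "C n (int n - 2) = n * 2 ^ (n - 2)"
proof -
  let ?O = "one_arc_pairs n"
  have "{(a, b). a \<in> compositions n \<and> b \<in> compositions n \<and> int (lie_index n (seaweed n a b)) = int n - 2}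
      = ?O \<union> prod.swap ` ?O"
    using lie_index_eq_iff[OF assms] by (auto simp: one_arc_pairs_def image_iff)
  moreover have "?O \<inter> prod.swap ` ?O = {}"
    by (auto simp: one_arc_pairs_def dest!: one_arc_length)
  ultimately have "C n (int n - 2) = card ?O + card (prod.swap ` ?O)"
    unfolding C_def using finite_one_arc_pairs by (simp add: card_Un_disjoint)
  also have "card (prod.swap ` ?O) = card ?O" by (rule card_image) simp
  also have "card ?O + card ?O = n * 2 ^ (n - 2)"
    using card_one_arc_pairs[of "n - 2"] by (simp only: le_add_diff_inverse2[OF assms] mult_2)
  finally show ?thesis .
qed

end
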